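(* Let $X\in\mathbb{R}^p$ be a random vector with a representation $X=AZ+E$, where - $A\in\mathbb{R}^{p\times k}$ is a (non-random) matrix with non-zero, pairwise non-proportional columns, - $Z\in\mathbb{R}^k$ is a random vector with mutually independent, non-constant, non-Gaussian components, and - $E\in\mathbb{R}^p$ is a (possibly degenerate) Gaussian random vector, $E\sim\mathcal{N}(\mu,\Sigma)$, with $\mu\in\mathbb{R}^p$ and positive semi-definite $\Sigma\in\mathbb{R}^{p\times p}$ of rank $r\le p$, such that $Z$ and $E$ are independent. Then there exist a matrix $B\in\mathbb{R}^{p\times r}$ of rank $r$ and a random vector $V\sim\mathcal{N}(0,I_r)$ such that $$\Sigma=BB^{\mathsf T},\qquad E=BV+\mu\ \text{ a.s.},\qquad Z \text{ and } V \text{ are independent},$$ which yields the representation $X=AZ+BV+\mu$. If $r=0$, then $B$ is the empty $p\times 0$ matrix, $V$ the empty vector and $E=\mu$ a.s. If $r\ge2$, then $B$ can moreover be chosen such that no column of $B$ is proportional to any column of $A$. Furthermore, for either choice of $B$ and for every $r\ge0$, we obtain a representation $$X=\begin{bmatrix}A&\widetilde B\end{bmatrix}\begin{bmatrix}\widetilde Z\\ \widetilde V\end{bmatrix}+\mu,$$ where - $\widetilde B\in\mathbb{R}^{p\times\tilde r}$ with $\tilde r\le r$ consists of those columns of $B$ that are not proportional to any column of $A$, and $\widetilde V\sim\mathcal{N}(0,I_{\tilde r})$ collects the corresponding components of $V$; - $\widetilde Z=Z+\widehat V$ with $\widehat V\sim\mathcal{N}(0,\Gamma)$ for a diagonal matrix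 $\Gamma$ (possibly with zeros on the diagonal), where $\{Z,\widehat V,\widetilde V\}$ is mutually independent; - every component of $\widetilde Z$ is non-Gaussian, the random vector $[\widetilde Z^{\mathsf T},\widetilde V^{\mathsf T}]^{\mathsf T}$ has mutually independent non-constant components, and the matrix $[A,\widetilde B]$ has non-zero, pairwise non-proportional columns.
   Context: A random vector $E$ in $\mathbb{R}^p$ is (possibly degenerate) Gaussian, $E\sim\mathcal{N}(\mu,\Sigma)$ with $\Sigma$ positive semi-definite (possibly singular), if its characteristic function is $\exp(it^{\mathsf T}\mu-\tfrac12t^{\mathsf T}\Sigma t)$; constants count as (degenerate) Gaussian. Non-constant means the law is not a Dirac measure. Two vectors $a,b$ are proportional if $a=\lambda b$ with $\lambda\in\mathbb{R}\setminus\{0\}$. $I_r$ is the $r\times r$ identity matrix. Identities between random vectors are understood almost surely. *)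

theory Defs
  imports "HOL-Probability.Probability" "Jordan_Normal_Form.DL_Rank"
begin

unbundle no vec_syntax
unbundle no inner_syntax

text \<open>Dimensions such as the rank \<open>r\<close> are derived quantities and may be \<open>0\<close>, so vectors
  and matrices are those of Jordan_Normal_Form, with carriers indexed by a natural number.\<close>

text \<open>The Borel sigma-algebra of \<open>R^n\<close>, transported from the product sigma-algebra on coordinates.\<close>

definition vec_borel :: "nat \<Rightarrow> real vec measure" where
  "vec_borel n = vimage_algebra (carrier_vec n) (\<lambda>v. \<lambda>i\<in>{..<n}. v $ i)
     (Pi\<^sub>M {..<n} (\<lambda>_. borel))"

lemma space_vec_borel [simp]: "space (vec_borel n) = carrier_vec n"
  by (simp add: vec_borel_def)

lemma measurable_vec_borel_iff:
  "X \<in> M \<rightarrow>\<^sub>M vec_borel n \<longleftrightarrow>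
     (\<forall>\<omega>\<in>space M. X \<omega> \<in> carrier_vec n) \<and> (\<forall>i<n. (\<lambda>\<omega>. X \<omega> $ i) \<in> borel_measurable M)"
proof (intro iffI conjI ballI allI impI)
  assume X: "X \<in> M \<rightarrow>\<^sub>M vec_borel n"
  show "X \<omega> \<in> carrier_vec n" if "\<omega> \<in> space M" for \<omega>
    using measurable_space[OF X that] by simp
  fix i assume i: "i < n"
  have f: "(\<lambda>v. \<lambda>i\<in>{..<n}. v $ i) \<in> vec_borel n \<rightarrow>\<^sub>M (Pi\<^sub>M {..<n} (\<lambda>_. borel :: real measure))"
    unfolding vec_borel_def by (rule measurable_vimage_algebra1) (auto simp: space_PiM)
  from measurable_compose[OF measurable_compose[OF X f] measurable_component_singleton[of i]] i
  show "(\<lambda>\<omega>. X \<omega> $ i) \<in> borel_measurable M" by simp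
next
  assume "(\<forall>\<omega>\<in>space M. X \<omega> \<in> carrier_vec n) \<and> (\<forall>i<n. (\<lambda>\<omega>. X \<omega> $ i) \<in> borel_measurable M)"
  then show "X \<in> M \<rightarrow>\<^sub>M vec_borel n"
    unfolding vec_borel_def
    by (intro measurable_vimage_algebra2 measurable_restrict) auto
qed

definition psd_mat :: "nat \<Rightarrow> real mat \<Rightarrow> bool" where
  "psd_mat n S \<longleftrightarrow> S \<in> carrier_mat n n \<and> S\<^sup>T = S \<and> (\<forall>t\<in>carrier_vec n. t \<bullet> (S *\<^sub>v t) \<ge> 0)"

text \<open>\<open>E ~ N(m, S)\<close> in \<open>R^n\<close>, possibly degenerate, via the characteristic function.\<close>

definition gaussian_vec ::
  "'a measure \<Rightarrow> nat \<Rightarrow> ('a \<Rightarrow> real vec) \<Rightarrow> real vec \<Rightarrow> real mat \<Rightarrow> bool" where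
  "gaussian_vec M n E m S \<longleftrightarrow>
     E \<in> M \<rightarrow>\<^sub>M vec_borel n \<and> m \<in> carrier_vec n \<and> psd_mat n S \<and>
     (\<forall>t\<in>carrier_vec n.
        (CLINT \<omega>|M. iexp (t \<bullet> E \<omega>)) =
          exp (\<i> * complex_of_real (t \<bullet> m) - complex_of_real (t \<bullet> (S *\<^sub>v t)) / 2))"

text \<open>The scalar notion is the case \<open>n = 1\<close>; constants are included, since the variance may vanish.\<close>

definition gaussian_rv :: "'a measure \<Rightarrow> ('a \<Rightarrow> real) \<Rightarrow> bool" where
  "gaussian_rv M Y \<longleftrightarrow> (\<exists>m S. gaussian_vec M 1 (\<lambda>\<omega>. vec 1 (\<lambda>_. Y \<omega>)) m S)"

lemma gaussian_rv_iff_char: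
  "gaussian_rv M Y \<longleftrightarrow>
     Y \<in> borel_measurable M \<and>
     (\<exists>m v. v \<ge> 0 \<and> (\<forall>t. char (distr M borel Y) t =
        exp (\<i> * complex_of_real (t * m) - complex_of_real (v * t\<^sup>2) / 2)))"
    (is "?L \<longleftrightarrow> ?R")
proof -
  have meas: "(\<lambda>\<omega>. vec 1 (\<lambda>_. Y \<omega>)) \<in> M \<rightarrow>\<^sub>M vec_borel 1 \<longleftrightarrow> Y \<in> borel_measurable M"
    by (simp add: measurable_vec_borel_iff)
  have ch: "char (distr M borel Y) s = (CLINT \<omega>|M. iexp (s * Y \<omega>))"
    if "Y \<in> borel_measurable M" for s
    unfolding char_def using that by (subst integral_distr) auto
  have quad: "t \<bullet> (S *\<^sub>v t) = S $$ (0,0) * (t $ 0)\<^sup>2"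
    if "t \<in> carrier_vec 1" "S \<in> carrier_mat 1 1" for t :: "real vec" and S
    using that by (auto simp: scalar_prod_def power2_eq_square)
  have dot: "t \<bullet> vec 1 (\<lambda>_. y) = t $ 0 * y" for t and y :: real
    by (simp add: scalar_prod_def)
  have dot': "t \<bullet> m = t $ 0 * m $ 0" if "m \<in> carrier_vec 1" for t m :: "real vec"
    using that by (simp add: scalar_prod_def)
  show ?thesis
  proof
    assume ?L
    then obtain m S where g: "gaussian_vec M 1 (\<lambda>\<omega>. vec 1 (\<lambda>_. Y \<omega>)) m S"
      unfolding gaussian_rv_def by blast
    then have Y: "Y \<in> borel_measurable M" and m: "m \<in> carrier_vec 1"
      and S: "S \<in> carrier_mat 1 1" and p: "\<forall>t\<in>carrier_vec 1. t \<bullet> (S *\<^sub>v t) \<ge> 0"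
      and e: "\<forall>t\<in>carrier_vec 1. (CLINT \<omega>|M. iexp (t \<bullet> vec 1 (\<lambda>_. Y \<omega>))) =
          exp (\<i> * complex_of_real (t \<bullet> m) - complex_of_real (t \<bullet> (S *\<^sub>v t)) / 2)"
      unfolding gaussian_vec_def psd_mat_def using meas by auto
    have "S $$ (0,0) \<ge> 0"
      using p[rule_format, of "vec 1 (\<lambda>_. 1)"] quad[of "vec 1 (\<lambda>_. 1)" S] S by simp
    moreover have "char (distr M borel Y) s =
        exp (\<i> * complex_of_real (s * m $ 0) - complex_of_real (S $$ (0,0) * s\<^sup>2) / 2)" for s
      using e[rule_format, of "vec 1 (\<lambda>_. s)"] quad[of "vec 1 (\<lambda>_. s)" S] S
        dot'[OF m, of "vec 1 (\<lambda>_. s)"] ch[OF Y, of s]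
      by (simp add: dot[unfolded One_nat_def])
    ultimately show ?R using Y by blast
  next
    assume ?R
    then obtain m v where Y: "Y \<in> borel_measurable M" and v: "v \<ge> 0"
      and e: "\<And>t. char (distr M borel Y) t =
        exp (\<i> * complex_of_real (t * m) - complex_of_real (v * t\<^sup>2) / 2)" by blast
    define S where "S = mat 1 1 (\<lambda>_. v)"
    have S: "S \<in> carrier_mat 1 1" "S $$ (0,0) = v" by (auto simp: S_def)
    have "S\<^sup>T = S" by (auto simp: S_def)
    then have psd: "psd_mat 1 S"
      unfolding psd_mat_def using S quad v by auto
    have gv: "(CLINT \<omega>|M. iexp (t \<bullet> vec 1 (\<lambda>_. Y \<omega>))) =
        exp (\<i> * complex_of_real (t \<bullet> vec 1 (\<lambda>_. m)) - complex_of_real (t \<bullet> (S *\<^sub>v t)) / 2)"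
      if "t \<in> carrier_vec 1" for t
      unfolding dot quad[OF that S(1)] S(2) using e[of "t $ 0"] ch[OF Y, of "t $ 0"] by argo
    have "gaussian_vec M 1 (\<lambda>\<omega>. vec 1 (\<lambda>_. Y \<omega>)) (vec 1 (\<lambda>_. m)) S"
      unfolding gaussian_vec_def using Y meas psd gv by (intro conjI ballI) (simp_all only: carrier_vec_def dim_vec mem_Collect_eq)
    then show ?L unfolding gaussian_rv_def by blast
  qed
qed

definition nonconstant_rv :: "'a measure \<Rightarrow> ('a \<Rightarrow> real) \<Rightarrow> bool" where
  "nonconstant_rv M Y \<longleftrightarrow> (\<forall>c. distr M borel Y \<noteq> return borel c)"

definition proportional :: "real vec \<Rightarrow> real vec \<Rightarrow> bool" where
  "proportional a b \<longleftrightarrow> (\<exists>c. c \<noteq> 0 \<and> a = c \<cdot>\<^sub>v b)"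

definition proper_cols :: "real mat \<Rightarrow> bool" where
  "proper_cols A \<longleftrightarrow>
     (\<forall>j<dim_col A. col A j \<noteq> 0\<^sub>v (dim_row A)) \<and>
     (\<forall>i<dim_col A. \<forall>j<dim_col A. i \<noteq> j \<longrightarrow> \<not> proportional (col A i) (col A j))"

definition hcat :: "real mat \<Rightarrow> real mat \<Rightarrow> real mat" where
  "hcat A B = mat_of_cols (dim_row A) (cols A @ cols B)"

definition gaussian_factor ::
  "'a measure \<Rightarrow> nat \<Rightarrow> nat \<Rightarrow> nat \<Rightarrow> ('a \<Rightarrow> real vec) \<Rightarrow> ('a \<Rightarrow> real vec) \<Rightarrow> real vec \<Rightarrow> real mat \<Rightarrow>
   real mat \<Rightarrow> ('a \<Rightarrow> real vec) \<Rightarrow> bool" where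
  "gaussian_factor M p k r Z E m S B V \<longleftrightarrow>
     B \<in> carrier_mat p r \<and> vec_space.rank p B = r \<and>
     gaussian_vec M r V (0\<^sub>v r) (1\<^sub>m r) \<and>
     S = B * B\<^sup>T \<and>
     (AE \<omega> in M. E \<omega> = B *\<^sub>v V \<omega> + m) \<and>
     prob_space.indep_var M (vec_borel k) Z (vec_borel r) V"

text \<open>Indices, in increasing order, of the columns of \<open>B\<close> not proportional to any column of \<open>A\<close>.\<close>

definition free_cols :: "real mat \<Rightarrow> real mat \<Rightarrow> nat list" where
  "free_cols A B =
     filter (\<lambda>l. \<forall>j<dim_col A. \<not> proportional (col B l) (col A j)) [0..<dim_col B]"

definition select_cols :: "real mat \<Rightarrow> nat list \<Rightarrow> real mat" where
  "select_cols B J = mat_of_cols (dim_row B) (map (col B) J)"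

definition select_entries :: "real vec \<Rightarrow> nat list \<Rightarrow> real vec" where
  "select_entries v J = vec_of_list (map (\<lambda>l. v $ l) J)"

end

theory Submission
  imports Defs
begin

text \<open>
  Let \<open>\<Sigma> = B B\<^sup>T\<close> with \<open>B\<close> of full column rank and let \<open>L\<close> be a left inverse of \<open>B\<close>. Then
  \<open>V = L (E - \<mu>)\<close> has covariance \<open>L B B\<^sup>T L\<^sup>T = I\<close>, while the residual \<open>(I - B L) (E - \<mu>)\<close> has
  covariance \<open>0\<close> and so vanishes almost surely. Hence \<open>E = B V + \<mu>\<close>, and \<open>V\<close> is independent of
  \<open>Z\<close> because it is a function of \<open>E\<close> (\<open>gaussian_factor_of_factorisation\<close>). The factor \<open>B\<close> comes from
  symmetric Gaussian elimination (\<open>psd_factor\<close>). Any \<open>B H\<close> with \<open>H\<close> orthogonal serves as well. For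
  \<open>r \<ge> 2\<close> the columns of the Householder reflection along \<open>(1, x, x\<^sup>2, \<dots>)\<close> move along curves that
  meet any given line only finitely often, so a suitable \<open>x\<close> keeps all columns of \<open>B H\<close> off the
  directions of the columns of \<open>A\<close> (\<open>rotate_factor_off_columns\<close>).

  For the second representation, let \<open>C\<^sub>j\<^sub>l = c\<close> if the \<open>l\<close>-th column of \<open>B\<close> is \<open>c\<close> times the \<open>j\<close>-th
  column of \<open>A\<close>, and \<open>C\<^sub>j\<^sub>l = 0\<close> if these columns are not proportional. The noise carried by
  the proportional columns is then absorbed into the signal: \<open>A Z + B V = A (Z + C V) + B' V'\<close>. Since the
  columns of \<open>A\<close> are pairwise non-proportional, a column of \<open>C\<close> has at most one non-zero entry.
  So \<open>C V\<close> has diagonal covariance, and each component of \<open>Z + C V\<close> and of \<open>V'\<close> depends on its own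
  block of the independent scalars \<open>Z\<^sub>1, \<dots>, Z\<^sub>k, V\<^sub>1, \<dots>, V\<^sub>r\<close>, which gives all independence claims
  (\<open>absorb_proportional_columns\<close>). A component of \<open>Z + C V\<close> cannot be Gaussian, since
  dividing out the characteristic function of its Gaussian part would make the component of \<open>Z\<close> Gaussian
  (\<open>gaussian_rv_summand\<close>).

  Gaussian vectors are given by their characteristic functions, so the independence of the components of
  \<open>V\<close> rests on Kac's theorem that random variables are independent if their joint characteristic function
  factorises (\<open>indep_vars_if_char_factorises\<close>). It follows from Levy's uniqueness theorem on the line
  by exchanging the exponentials for indicators, one coordinate at a time.
\<close>

section \<open>Independence from characteristic functions\<close>

text \<open>The hypothesis says that the finite measure with density \<open>g\<close> pushes forward along \<open>X\<close> to a
  measure whose characteristic function is \<open>c\<close> times that of \<open>X\<close>. After division by the total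
  mass \<open>c\<close> this is Levy's uniqueness theorem for probability measures on the line; if \<open>c = 0\<close>, then
  \<open>g\<close> vanishes almost everywhere.\<close>
lemma (in prob_space) weighted_char_proportional:
  fixes g X :: "'a \<Rightarrow> real"
  assumes X [measurable]: "X \<in> borel_measurable M"
    and g [simp]: "integrable M g" and g0: "\<And>\<omega>. g \<omega> \<ge> 0"
    and ch: "\<And>t. (CLINT \<omega>|M. of_real (g \<omega>) * iexp (t * X \<omega>)) =
               of_real c * (CLINT \<omega>|M. iexp (t * X \<omega>))"
    and B [measurable]: "B \<in> sets borel"
  shows "(LINT \<omega>|M. g \<omega> * indicator B (X \<omega>)) = c * prob (X -` B \<inter> space M)"
proof -
  have [measurable]: "g \<in> borel_measurable M" by (rule borel_measurable_integrable) simp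
  have c: "c = (LINT \<omega>|M. g \<omega>)"
    using ch[of 0] by (simp add: prob_space)
  have "c \<ge> 0" unfolding c by (rule Bochner_Integration.integral_nonneg) (rule g0)
  show ?thesis
  proof (cases "c = 0")
    case True
    have "AE \<omega> in M. g \<omega> = 0"
      using integral_nonneg_eq_0_iff_AE[OF g] g0 True c by simp
    then have "(LINT \<omega>|M. g \<omega> * indicator B (X \<omega>)) = (LINT \<omega>|M. 0)"
      by (intro integral_cong_AE) auto
    then show ?thesis using True by simp
  next
    case False
    with \<open>c \<ge> 0\<close> have c0: "c > 0" by simp
    define N where "N = density M (\<lambda>\<omega>. ennreal (g \<omega> / c))"
    have "(\<integral>\<^sup>+\<omega>. ennreal (g \<omega> / c) \<partial>M) = ennreal (LINT \<omega>|M. g \<omega> / c)"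
      using g0 c0 by (intro nn_integral_eq_integral) auto
    also have "\<dots> = 1" using c c0 by simp
    finally have "emeasure N (space N) = 1"
      by (simp add: N_def emeasure_density cong: nn_integral_cong)
    then interpret N: prob_space N by (rule prob_spaceI)
    have XN [measurable]: "X \<in> borel_measurable N" by (simp add: N_def)
    interpret DN: real_distribution "distr N borel X" by (rule N.real_distribution_distr) (rule XN)
    interpret DM: real_distribution "distr M borel X" by (rule real_distribution_distr) (rule X)
    have "char (distr N borel X) t = char (distr M borel X) t" for t
    proof -
      have "char (distr N borel X) t = (CLINT \<omega>|N. iexp (t * X \<omega>))"
        unfolding char_def by (subst integral_distr) auto
      also have "\<dots> = (CLINT \<omega>|M. (g \<omega> / c) *\<^sub>R iexp (t * X \<omega>))"
        unfolding N_def using g0 c0 by (subst integral_density) auto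
      also have "\<dots> = (CLINT \<omega>|M. of_real (1/c) * (of_real (g \<omega>) * iexp (t * X \<omega>)))"
        by (intro Bochner_Integration.integral_cong) (auto simp: scaleR_conv_of_real)
      also have "\<dots> = of_real (1/c) * (CLINT \<omega>|M. of_real (g \<omega>) * iexp (t * X \<omega>))"
        by (rule integral_mult_right_zero)
      also have "\<dots> = (CLINT \<omega>|M. iexp (t * X \<omega>))"
        unfolding ch using c0 by simp
      also have "\<dots> = char (distr M borel X) t"
        unfolding char_def by (subst integral_distr) auto
      finally show ?thesis .
    qed
    then have eq: "distr N borel X = distr M borel X"
      by (intro Levy_uniqueness DN.real_distribution_axioms DM.real_distribution_axioms ext)
    have "(LINT \<omega>|M. g \<omega> * indicator B (X \<omega>)) = c * (LINT \<omega>|M. (g \<omega> / c) *\<^sub>R indicator B (X \<omega>))"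
      using c0 by (subst integral_mult_right_zero[symmetric]) simp
    also have "(LINT \<omega>|M. (g \<omega> / c) *\<^sub>R (indicator B (X \<omega>) :: real)) = (LINT \<omega>|N. indicator B (X \<omega>))"
      unfolding N_def using g0 c0 by (subst integral_density) auto
    also have "\<dots> = (LINT x|distr N borel X. indicator B x)"
      by (subst integral_distr) auto
    also have "\<dots> = (LINT \<omega>|M. indicator B (X \<omega>))"
      unfolding eq by (subst integral_distr) auto
    also have "\<dots> = (LINT \<omega>|M. indicator (X -` B \<inter> space M) \<omega>)"
      by (intro Bochner_Integration.integral_cong) (auto simp: indicator_def)
    also have "\<dots> = prob (X -` B \<inter> space M)" by simp
    finally show ?thesis .
  qed
qed

text \<open>A complex weight \<open>G\<close> with \<open>\<bar>G\<bar> \<le> 1\<close> is reduced to the non-negative weights \<open>1 + Re G\<close> and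
  \<open>1 + Im G\<close>: conjugating the hypothesis at \<open>-t\<close> shows that \<open>cnj G\<close> satisfies it with constant
  \<open>cnj c\<close>, hence \<open>1 + Re G\<close> satisfies it with constant \<open>1 + Re c\<close>.\<close>
lemma (in prob_space) complex_weighted_char_proportional:
  fixes G :: "'a \<Rightarrow> complex" and X :: "'a \<Rightarrow> real"
  assumes X [measurable]: "X \<in> borel_measurable M"
    and G [measurable]: "G \<in> borel_measurable M" and G1: "\<And>\<omega>. norm (G \<omega>) \<le> 1"
    and ch: "\<And>t. (CLINT \<omega>|M. G \<omega> * iexp (t * X \<omega>)) = c * (CLINT \<omega>|M. iexp (t * X \<omega>))"
    and B [measurable]: "B \<in> sets borel"
  shows "(CLINT \<omega>|M. G \<omega> * indicator B (X \<omega>)) = c * of_real (prob (X -` B \<inter> space M))"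
proof -
  have *: "(LINT \<omega>|M. Re (F \<omega>) * indicator B (X \<omega>)) = Re d * prob (X -` B \<inter> space M)"
    if F [measurable]: "F \<in> borel_measurable M" and F1: "\<And>\<omega>. norm (F \<omega>) \<le> 1"
      and chF: "\<And>t. (CLINT \<omega>|M. F \<omega> * iexp (t * X \<omega>)) = d * (CLINT \<omega>|M. iexp (t * X \<omega>))"
    for F :: "'a \<Rightarrow> complex" and d
  proof -
    have int: "integrable M (\<lambda>\<omega>. H \<omega> * iexp (t * X \<omega>))"
      if [measurable]: "H \<in> borel_measurable M" and "\<And>\<omega>. norm (H \<omega>) \<le> 1" for H :: "'a \<Rightarrow> complex" and t
      using that by (intro integrable_const_bound[of _ 1]) (auto simp: norm_mult)
    have abs: "\<bar>Re (F \<omega>)\<bar> \<le> 1" for \<omega> using abs_Re_le_cmod F1 order_trans by blast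
    have intR: "integrable M (\<lambda>\<omega>. Re (F \<omega>))"
      using abs by (intro integrable_const_bound[of _ 1]) auto
    have intRB: "integrable M (\<lambda>\<omega>. Re (F \<omega>) * indicator B (X \<omega>))"
      using abs by (intro integrable_const_bound[of _ 1]) (auto simp: indicator_def)
    have cF: "(CLINT \<omega>|M. cnj (F \<omega>) * iexp (t * X \<omega>)) = cnj d * (CLINT \<omega>|M. iexp (t * X \<omega>))" for t
    proof -
      have "(CLINT \<omega>|M. cnj (F \<omega>) * iexp (t * X \<omega>)) = (CLINT \<omega>|M. cnj (F \<omega> * iexp ((-t) * X \<omega>)))"
        by (simp add: exp_cnj)
      also have "\<dots> = cnj (CLINT \<omega>|M. F \<omega> * iexp ((-t) * X \<omega>))" by (rule Bochner_Integration.integral_cnj)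
      also have "\<dots> = cnj d * cnj (CLINT \<omega>|M. iexp ((-t) * X \<omega>))" by (simp only: chF complex_cnj_mult)
      also have "cnj (CLINT \<omega>|M. iexp ((-t) * X \<omega>)) = (CLINT \<omega>|M. iexp (t * X \<omega>))"
        by (subst Bochner_Integration.integral_cnj[symmetric]) (simp add: exp_cnj)
      finally show ?thesis .
    qed
    have "(LINT \<omega>|M. (1 + Re (F \<omega>)) * indicator B (X \<omega>)) = (1 + Re d) * prob (X -` B \<inter> space M)"
    proof (rule weighted_char_proportional)
      show "0 \<le> 1 + Re (F \<omega>)" for \<omega> using abs[of \<omega>] by linarith
      fix t
      have "(\<lambda>\<omega>. cnj (F \<omega>)) \<in> borel_measurable M"
        by (rule measurable_compose[OF F]) (intro borel_measurable_continuous_onI continuous_intros)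
      then have i1: "integrable M (\<lambda>\<omega>. cnj (F \<omega>) * iexp (t * X \<omega>))" using F1 by (intro int) auto
      have i2: "integrable M (\<lambda>\<omega>. F \<omega> * iexp (t * X \<omega>))" by (intro int F F1)
      have i3: "integrable M (\<lambda>\<omega>. 1 * iexp (t * X \<omega>))" by (intro int) auto
      have "(CLINT \<omega>|M. of_real (1 + Re (F \<omega>)) * iexp (t * X \<omega>)) =
        (CLINT \<omega>|M. 1 * iexp (t * X \<omega>) + (F \<omega> * iexp (t * X \<omega>) + cnj (F \<omega>) * iexp (t * X \<omega>)) / 2)"
        by (intro Bochner_Integration.integral_cong refl)
          (simp add: complex_eq_iff field_simps)
      also have "\<dots> = (CLINT \<omega>|M. 1 * iexp (t * X \<omega>)) +
         ((CLINT \<omega>|M. F \<omega> * iexp (t * X \<omega>)) + (CLINT \<omega>|M. cnj (F \<omega>) * iexp (t * X \<omega>))) / 2"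
        using i3 i1 i2
        by (simp only: Bochner_Integration.integral_add Bochner_Integration.integrable_add integral_divide_zero integrable_divide simp_thms)
      also have "\<dots> = of_real (1 + Re d) * (CLINT \<omega>|M. iexp (t * X \<omega>))"
        unfolding chF cF by (simp add: complex_eq_iff field_simps)
      finally show "(CLINT \<omega>|M. of_real (1 + Re (F \<omega>)) * iexp (t * X \<omega>)) = \<dots>" .
    qed (use intR in auto)
    moreover have "(LINT \<omega>|M. (1 + Re (F \<omega>)) * indicator B (X \<omega>)) =
       (LINT \<omega>|M. indicator (X -` B \<inter> space M) \<omega> + Re (F \<omega>) * indicator B (X \<omega>))"
      by (intro Bochner_Integration.integral_cong) (auto simp: indicator_def)
    moreover have "\<dots> = prob (X -` B \<inter> space M) + (LINT \<omega>|M. Re (F \<omega>) * indicator B (X \<omega>))"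
      using intRB by (subst Bochner_Integration.integral_add) (auto simp: emeasure_eq_measure)
    ultimately show ?thesis by (simp add: algebra_simps)
  qed
  have 1: "(LINT \<omega>|M. Re (G \<omega>) * indicator B (X \<omega>)) = Re c * prob (X -` B \<inter> space M)"
    by (rule *[OF G G1 ch])
  \<comment> \<open>The imaginary part of \<open>G\<close> is the real part of \<open>- \<i> G\<close>.\<close>
  have 2: "(LINT \<omega>|M. Re (- \<i> * G \<omega>) * indicator B (X \<omega>)) = Re (- \<i> * c) * prob (X -` B \<inter> space M)"
  proof (rule *)
    show "(CLINT \<omega>|M. - \<i> * G \<omega> * iexp (t * X \<omega>)) = - \<i> * c * (CLINT \<omega>|M. iexp (t * X \<omega>))" for t
      using ch[of t] by (simp only: mult.assoc integral_mult_right_zero)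
  qed (use G1 in \<open>auto simp: norm_mult\<close>)
  have int: "integrable M (\<lambda>\<omega>. G \<omega> * indicator B (X \<omega>))"
    using G1 by (intro integrable_const_bound[of _ 1]) (auto simp: norm_mult indicator_def)
  show ?thesis
  proof (rule complex_eqI)
    have "Re (G \<omega> * indicator B (X \<omega>)) = Re (G \<omega>) * indicator B (X \<omega>)"
      "Im (G \<omega> * indicator B (X \<omega>)) = Re (- \<i> * G \<omega>) * indicator B (X \<omega>)" for \<omega>
      by (auto simp: indicator_def)
    note parts = this
    show "Re (CLINT \<omega>|M. G \<omega> * indicator B (X \<omega>)) = Re (c * of_real (prob (X -` B \<inter> space M)))"
      unfolding integral_Re[OF int, symmetric] parts using 1 by simp
    show "Im (CLINT \<omega>|M. G \<omega> * indicator B (X \<omega>)) = Im (c * of_real (prob (X -` B \<inter> space M)))"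
      unfolding integral_Im[OF int, symmetric] parts using 2 by simp
  qed
qed

text \<open>Kac's theorem. The exponentials in the hypothesis are replaced by indicators of Borel sets one
  coordinate at a time. Replacing the \<open>j\<close>-th one uses the product of all other factors, which
  has modulus at most one, as the complex weight. Once every factor is an indicator, the identity
  is the product formula for boxes.\<close>
lemma (in prob_space) indep_vars_if_char_factorises:
  fixes X :: "'i \<Rightarrow> 'a \<Rightarrow> real"
  assumes I: "finite I" and X: "\<And>i. i \<in> I \<Longrightarrow> X i \<in> borel_measurable M"
    and ch: "\<And>t. (CLINT \<omega>|M. \<Prod>i\<in>I. iexp (t i * X i \<omega>)) = (\<Prod>i\<in>I. CLINT \<omega>|M. iexp (t i * X i \<omega>))"
  shows "indep_vars (\<lambda>_. borel) X I"
proof (cases "I = {}")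
  case True
  then show ?thesis by (simp add: indep_vars_def indep_sets_def)
next
  case False
  have mixed: "(CLINT \<omega>|M. (\<Prod>i\<in>S. indicator (B i) (X i \<omega>)) * (\<Prod>i\<in>I-S. iexp (t i * X i \<omega>))) =
      (\<Prod>i\<in>S. of_real (prob (X i -` B i \<inter> space M))) * (\<Prod>i\<in>I-S. CLINT \<omega>|M. iexp (t i * X i \<omega>))"
    if "finite S" "S \<subseteq> I" "\<And>i. i \<in> S \<Longrightarrow> B i \<in> sets borel" for S B t
    using that
  proof (induction S arbitrary: t rule: finite_induct)
    case empty
    then show ?case using ch[of t] by simp
  next
    case (insert j S)
    have j: "j \<in> I" and Bj: "B j \<in> sets borel" and S: "S \<subseteq> I" using insert.prems by auto
    have rest: "I - S = insert j (I - insert j S)" "j \<notin> I - insert j S" using j insert.hyps by auto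
    have m [measurable]: "X i \<in> borel_measurable M" "i \<in> S \<Longrightarrow> B i \<in> sets borel" if "i \<in> I" for i
      using X insert.prems that by auto
    define G where "G \<omega> = (\<Prod>i\<in>S. indicator (B i) (X i \<omega>)) * (\<Prod>i\<in>I - insert j S. iexp (t i * X i \<omega>))" for \<omega>
    define c :: complex where "c = (\<Prod>i\<in>S. of_real (prob (X i -` B i \<inter> space M))) *
                       (\<Prod>i\<in>I - insert j S. CLINT \<omega>|M. iexp (t i * X i \<omega>))"
    have "(CLINT \<omega>|M. G \<omega> * indicator (B j) (X j \<omega>)) = c * of_real (prob (X j -` B j \<inter> space M))"
    proof (rule complex_weighted_char_proportional[OF _ _ _ _ Bj])
      have [measurable]: "(\<lambda>\<omega>. indicator (B i) (X i \<omega>) :: complex) \<in> borel_measurable M" if "i \<in> S" for i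
        using S insert.prems m that by (intro measurable_compose[OF m(1)[of i]]) auto
      have e: "(\<lambda>\<omega>. iexp (t i * X i \<omega>)) \<in> borel_measurable M" if "i \<in> I" for i
        using m(1)[OF that] by measurable
      show "G \<in> borel_measurable M" unfolding G_def
        using e by (intro borel_measurable_times borel_measurable_prod) auto
      show "norm (G \<omega>) \<le> 1" for \<omega>
      proof -
        have "norm (G \<omega>) = (\<Prod>i\<in>S. norm (indicator (B i) (X i \<omega>) :: complex)) * 1"
          unfolding G_def by (simp add: norm_mult flip: prod_norm)
        also have "\<dots> \<le> 1" by (auto intro!: prod_le_1 simp: indicator_def)
        finally show ?thesis .
      qed
      fix s
      let ?t = "t(j := s)"
      have split: "(\<Prod>i\<in>I-S. f (?t i) i) = f s j * (\<Prod>i\<in>I - insert j S. f (t i) i)"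
        for f :: "real \<Rightarrow> 'i \<Rightarrow> complex"
        unfolding rest(1) using I rest(2) by (subst prod.insert) (auto intro!: prod.cong)
      \<comment> \<open>The induction hypothesis is applied with the \<open>j\<close>-th frequency changed to \<open>s\<close>.\<close>
      have "(CLINT \<omega>|M. G \<omega> * iexp (s * X j \<omega>)) =
         (CLINT \<omega>|M. (\<Prod>i\<in>S. indicator (B i) (X i \<omega>)) * (\<Prod>i\<in>I-S. iexp (?t i * X i \<omega>)))"
        unfolding G_def split[of "\<lambda>x i. iexp (x * X i _)"] by (simp only: mult_ac)
      also have "\<dots> = (\<Prod>i\<in>S. of_real (prob (X i -` B i \<inter> space M))) * (\<Prod>i\<in>I-S. CLINT \<omega>|M. iexp (?t i * X i \<omega>))"
        using insert.prems by (intro insert.IH) auto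
      also have "\<dots> = c * (CLINT \<omega>|M. iexp (s * X j \<omega>))"
        unfolding c_def split[of "\<lambda>x i. CLINT \<omega>|M. iexp (x * X i \<omega>)"] by (simp only: mult_ac)
      finally show "(CLINT \<omega>|M. G \<omega> * iexp (s * X j \<omega>)) = c * (CLINT \<omega>|M. iexp (s * X j \<omega>))" .
    qed (use j X in auto)
    then show ?case
      unfolding G_def c_def using insert.hyps by (simp add: mult_ac)
  qed
  have box: "prob (\<Inter>i\<in>I. X i -` B i \<inter> space M) = (\<Prod>i\<in>I. prob (X i -` B i \<inter> space M))"
    if B: "\<And>i. i \<in> I \<Longrightarrow> B i \<in> sets borel" for B
  proof -
    have meas: "(\<Inter>i\<in>I. X i -` B i \<inter> space M) \<in> events"
      using False I X B by (intro sets.finite_INT measurable_sets) auto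
    have "complex_of_real (prob (\<Inter>i\<in>I. X i -` B i \<inter> space M)) =
        of_real (LINT \<omega>|M. indicator (\<Inter>i\<in>I. X i -` B i \<inter> space M) \<omega>)"
      using meas by simp
    also have "\<dots> = (CLINT \<omega>|M. of_real (indicator (\<Inter>i\<in>I. X i -` B i \<inter> space M) \<omega>))"
      by simp
    also have "\<dots> = (CLINT \<omega>|M. (\<Prod>i\<in>I. indicator (B i) (X i \<omega>)))"
      using I by (intro Bochner_Integration.integral_cong) (auto simp: indicator_def)
    also have "\<dots> = of_real (\<Prod>i\<in>I. prob (X i -` B i \<inter> space M))"
      using mixed[of I B "\<lambda>_. 0"] I B by simp
    finally show ?thesis by (simp only: of_real_eq_iff)
  qed
  show ?thesis
    unfolding indep_vars_def2
  proof (intro conjI ballI)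
    show "indep_sets (\<lambda>i. {X i -` A \<inter> space M |A. A \<in> sets borel}) I"
    proof (subst indep_sets_finite[OF False I])
      show "{X i -` A \<inter> space M |A. A \<in> sets borel} \<subseteq> events" if "i \<in> I" for i
        using X[OF that] by (auto intro: measurable_sets)
      show "space M \<in> {X i -` A \<inter> space M |A. A \<in> sets borel}" if "i \<in> I" for i
        by (auto intro!: exI[of _ UNIV])
      show "\<forall>A\<in>Pi I (\<lambda>i. {X i -` A \<inter> space M |A. A \<in> sets borel}). prob (\<Inter> (A ` I)) = (\<Prod>j\<in>I. prob (A j))"
      proof
        fix A assume "A \<in> Pi I (\<lambda>i. {X i -` A \<inter> space M |A. A \<in> sets borel})"
        then have "\<forall>i\<in>I. \<exists>B. B \<in> sets borel \<and> A i = X i -` B \<inter> space M" by (auto simp: Pi_iff)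
        then obtain B where "\<And>i. i \<in> I \<Longrightarrow> B i \<in> sets borel" "\<And>i. i \<in> I \<Longrightarrow> A i = X i -` B i \<inter> space M"
          by metis
        then show "prob (\<Inter> (A ` I)) = (\<Prod>j\<in>I. prob (A j))" using box[of B] by simp
      qed
    qed
  qed (use X in auto)
qed

section \<open>Full-rank factors of positive semi-definite matrices\<close>

lemma mult_mat_unit_vec:
  fixes A :: "'a :: semiring_1 mat"
  assumes "A \<in> carrier_mat n m" "i < m"
  shows "A *\<^sub>v unit_vec m i = col A i"
  using assms by (intro eq_vecI) auto

lemma real_scalar_prod_self_eq_0:
  fixes v :: "real vec"
  assumes v: "v \<in> carrier_vec n" and 0: "v \<bullet> v = 0"
  shows "v = 0\<^sub>v n"
proof -
  have "(\<Sum>i = 0..<n. v $ i * v $ i) = 0" using 0 v by (simp add: scalar_prod_def)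
  then have "v $ i = 0" if "i < n" for i
    using that by (subst (asm) sum_nonneg_eq_0_iff) auto
  then show ?thesis using v by (intro eq_vecI) auto
qed

text \<open>The rank is the dimension of the span of the \<^emph>\<open>set\<close> of columns, so full rank first has to
  exclude repeated columns before it can be read as linear independence.\<close>
lemma full_column_rank_iff_injective:
  fixes B :: "real mat"
  assumes B: "B \<in> carrier_mat n m"
  shows "vec_space.rank n B = m \<longleftrightarrow> (\<forall>v\<in>carrier_vec m. B *\<^sub>v v = 0\<^sub>v n \<longrightarrow> v = 0\<^sub>v m)"
proof -
  interpret vec_space "TYPE(real)" n .
  show ?thesis
  proof
    assume rk: "rank B = m"
    obtain S where S: "maximal S (\<lambda>T. T \<subseteq> set (cols B) \<and> lin_indpt T)"
      using maximal_exists_superset[of "set (cols B)" "\<lambda>T. T \<subseteq> set (cols B) \<and> lin_indpt T" "{}"]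
      by (auto simp: finite_lin_indpt2)
    have "S \<subseteq> set (cols B)" using S by (simp add: maximal_def)
    then have "m \<le> card (set (cols B))"
      using rank_card_indpt[OF B S] rk by (simp add: card_mono)
    moreover have "card (set (cols B)) \<le> length (cols B)" by (rule card_length)
    moreover have "length (cols B) = m" using B by simp
    ultimately have dist: "distinct (cols B)" by (intro card_distinct) simp
    show "\<forall>v\<in>carrier_vec m. B *\<^sub>v v = 0\<^sub>v n \<longrightarrow> v = 0\<^sub>v m"
      using lin_depI[OF B _ _ _ dist] full_rank_lin_indpt[OF B rk dist] by blast
  next
    assume inj: "\<forall>v\<in>carrier_vec m. B *\<^sub>v v = 0\<^sub>v n \<longrightarrow> v = 0\<^sub>v m"
    have "distinct (cols B)"
    proof (rule ccontr)
      assume "\<not> distinct (cols B)"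
      then obtain i j where ij: "i < m" "j < m" "i \<noteq> j" "col B i = col B j"
        using B by (auto simp: distinct_conv_nth)
      let ?v = "unit_vec m i - unit_vec m j :: real vec"
      have "B *\<^sub>v ?v = col B i - col B j"
        using B ij by (simp add: mult_minus_distrib_mat_vec mult_mat_unit_vec)
      also have "\<dots> = 0\<^sub>v n" using B ij by (metis carrier_matD(1) col_dim minus_cancel_vec)
      finally have "?v = 0\<^sub>v m" using inj by auto
      then have "?v $ i = 0" using ij by simp
      then show False using ij by simp
    qed
    then show "rank B = m"
      using lin_indpt_full_rank[OF B] lin_depE[OF B] inj by metis
  qed
qed

text \<open>The Gram matrix \<open>B\<^sup>T B\<close> is invertible because \<open>B\<^sup>T B v = 0\<close> forces \<open>\<bar>B v\<bar>\<^sup>2 = 0\<close>; the left inverse is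
  \<open>(B\<^sup>T B)\<^sup>-\<^sup>1 B\<^sup>T\<close>.\<close>
lemma injective_left_inverse:
  fixes B :: "real mat"
  assumes B: "B \<in> carrier_mat n m"
    and inj: "\<And>v. v \<in> carrier_vec m \<Longrightarrow> B *\<^sub>v v = 0\<^sub>v n \<Longrightarrow> v = 0\<^sub>v m"
  obtains L where "L \<in> carrier_mat m n" "L * B = 1\<^sub>m m"
proof -
  define G where "G = B\<^sup>T * B"
  have G: "G \<in> carrier_mat m m" using B by (simp add: G_def)
  have "det G \<noteq> 0"
  proof
    assume "det G = 0"
    then obtain v where v: "v \<in> carrier_vec m" "v \<noteq> 0\<^sub>v m" "G *\<^sub>v v = 0\<^sub>v m"
      using det_0_iff_vec_prod_zero_field[OF G] by auto
    have "(B *\<^sub>v v) \<bullet> (B *\<^sub>v v) = (B\<^sup>T *\<^sub>v (B *\<^sub>v v)) \<bullet> v"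
      using B v by (intro transpose_vec_mult_scalar[symmetric]) auto
    also have "B\<^sup>T *\<^sub>v (B *\<^sub>v v) = 0\<^sub>v m"
      using B v unfolding G_def by (metis assoc_mult_mat_vec transpose_carrier_mat)
    finally have "(B *\<^sub>v v) \<bullet> (B *\<^sub>v v) = 0" using v by simp
    then have "B *\<^sub>v v = 0\<^sub>v n"
      using B v by (intro real_scalar_prod_self_eq_0) auto
    with inj v show False by auto
  qed
  define L where "L = (1 / det G) \<cdot>\<^sub>m (adj_mat G * B\<^sup>T)"
  note adj = adj_mat[OF G]
  have "L * B = (1 / det G) \<cdot>\<^sub>m (adj_mat G * G)"
    using B adj(1) unfolding L_def by (simp add: mult_smult_assoc_mat[of _ m n _ m] assoc_mult_mat[of _ m m _ n _ m] G_def)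
  also have "\<dots> = 1\<^sub>m m" unfolding adj(3) using \<open>det G \<noteq> 0\<close> by (auto intro!: eq_matI)
  finally show thesis using B adj(1) by (intro that[of L]) (auto simp: L_def)
qed

text \<open>For a left inverse \<open>L\<close> of \<open>B\<close> one has \<open>B y = B B\<^sup>T (L\<^sup>T y)\<close>, so \<open>B\<close> and \<open>B B\<^sup>T\<close> have the same column
  space.\<close>
lemma rank_mult_transpose:
  fixes B :: "real mat"
  assumes B: "B \<in> carrier_mat n m" and rk: "vec_space.rank n B = m"
  shows "vec_space.rank n (B * B\<^sup>T) = m"
proof -
  interpret vec_space "TYPE(real)" n .
  obtain L where L: "L \<in> carrier_mat m n" "L * B = 1\<^sub>m m"
    using injective_left_inverse[OF B] full_column_rank_iff_injective[OF B] rk by metis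
  have BT: "B * B\<^sup>T \<in> carrier_mat n n" using B by simp
  have "B\<^sup>T * L\<^sup>T = 1\<^sub>m m"
    using transpose_mult[OF L(1) B] L(2) by simp
  have "B *\<^sub>v y = (B * B\<^sup>T) *\<^sub>v (L\<^sup>T *\<^sub>v y)" if y: "y \<in> carrier_vec m" for y
  proof -
    have "(B * B\<^sup>T) *\<^sub>v (L\<^sup>T *\<^sub>v y) = B *\<^sub>v (B\<^sup>T *\<^sub>v (L\<^sup>T *\<^sub>v y))"
      using B L y by (intro assoc_mult_mat_vec) auto
    also have "B\<^sup>T *\<^sub>v (L\<^sup>T *\<^sub>v y) = (B\<^sup>T * L\<^sup>T) *\<^sub>v y"
      using B L y by (intro assoc_mult_mat_vec[symmetric]) auto
    finally show ?thesis using y \<open>B\<^sup>T * L\<^sup>T = 1\<^sub>m m\<close> by simp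
  qed
  moreover have "(B * B\<^sup>T) *\<^sub>v x = B *\<^sub>v (B\<^sup>T *\<^sub>v x)" if "x \<in> carrier_vec n" for x
    using B that by (intro assoc_mult_mat_vec) auto
  ultimately have "col_space (B * B\<^sup>T) = col_space B"
    unfolding col_space_eq[OF B] col_space_eq[OF BT] using B L
    by (auto 0 3 intro: bexI[of _ "B\<^sup>T *\<^sub>v _"] bexI[of _ "L\<^sup>T *\<^sub>v _"])
  then show ?thesis using rk unfolding rank_def col_space_def by simp
qed

lemma quadratic_form_shift:
  fixes S :: "real mat"
  assumes S: "S \<in> carrier_mat n n" "S\<^sup>T = S" and t: "t \<in> carrier_vec n" and i: "i < n"
  shows "(t + x \<cdot>\<^sub>v unit_vec n i) \<bullet> (S *\<^sub>v (t + x \<cdot>\<^sub>v unit_vec n i)) =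
         t \<bullet> (S *\<^sub>v t) + 2 * x * (S *\<^sub>v t) $ i + x\<^sup>2 * S $$ (i,i)"
proof -
  let ?e = "unit_vec n i :: real vec"
  have Se: "S *\<^sub>v ?e \<in> carrier_vec n" and St: "S *\<^sub>v t \<in> carrier_vec n" using S t by auto
  have 1: "S *\<^sub>v (t + x \<cdot>\<^sub>v ?e) = S *\<^sub>v t + x \<cdot>\<^sub>v (S *\<^sub>v ?e)"
    using S t by (simp add: mult_add_distrib_mat_vec mult_mat_vec)
  have 2: "?e \<bullet> (S *\<^sub>v t) = (S *\<^sub>v t) $ i" using St i by simp
  have 3: "t \<bullet> (S *\<^sub>v ?e) = (S *\<^sub>v t) $ i"
    using transpose_vec_mult_scalar[of S n n ?e t] S t i by simp
  have 4: "?e \<bullet> (S *\<^sub>v ?e) = S $$ (i,i)" using S Se i by (simp add: mult_mat_unit_vec)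
  show ?thesis unfolding 1 using 2 3 4 t Se St
    by (simp add: add_scalar_prod_distrib[of _ n] scalar_prod_add_distrib[of _ n]
        smult_scalar_prod_distrib[of _ n] scalar_prod_smult_distrib[of _ n] power2_eq_square algebra_simps)
qed

text \<open>Otherwise the quadratic form would be affine and non-constant, hence somewhere negative, along the line
  \<open>e\<^sub>b + x e\<^sub>i\<close>.\<close>
lemma psd_zero_diag_zero_row:
  assumes S: "psd_mat n S" and i: "i < n" "b < n" and 0: "S $$ (i,i) = 0"
  shows "S $$ (i,b) = 0"
proof (rule ccontr)
  assume nz: "S $$ (i,b) \<noteq> 0"
  have SC: "S \<in> carrier_mat n n" "S\<^sup>T = S" and pos: "\<And>t. t \<in> carrier_vec n \<Longrightarrow> t \<bullet> (S *\<^sub>v t) \<ge> 0"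
    using S by (auto simp: psd_mat_def)
  let ?e = "unit_vec n b :: real vec"
  have e: "?e \<bullet> (S *\<^sub>v ?e) = S $$ (b,b)" "(S *\<^sub>v ?e) $ i = S $$ (i,b)"
    using SC i by (auto simp: mult_mat_unit_vec)
  have "S $$ (b,b) + 2 * x * S $$ (i,b) \<ge> 0" for x
    using pos[of "?e + x \<cdot>\<^sub>v unit_vec n i"] quadratic_form_shift[OF SC, of ?e i x] i e 0 by simp
  from this[of "- (S $$ (b,b) + 1) / (2 * S $$ (i,b))"] nz show False by (simp add: field_simps)
qed

text \<open>One step of symmetric Gaussian elimination. The value of the Schur complement at \<open>t\<close> is the
  minimum over \<open>x\<close> of the quadratic form of \<open>S\<close> at \<open>t + x e\<^sub>i\<close>, hence non-negative.\<close>
lemma psd_deflate: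
  assumes S: "psd_mat n S" and i: "i < n" and s: "S $$ (i,i) > 0"
  defines "S' \<equiv> mat n n (\<lambda>(a,b). S $$ (a,b) - S $$ (a,i) * S $$ (b,i) / S $$ (i,i))"
  shows "psd_mat n S'"
proof -
  have SC: "S \<in> carrier_mat n n" "S\<^sup>T = S" and pos: "\<And>t. t \<in> carrier_vec n \<Longrightarrow> t \<bullet> (S *\<^sub>v t) \<ge> 0"
    using S by (auto simp: psd_mat_def)
  have sym: "S $$ (a,b) = S $$ (b,a)" if "a < n" "b < n" for a b
    using SC that by (metis carrier_matD index_transpose_mat(1))
  have "S'\<^sup>T = S'" by (rule eq_matI) (auto simp: S'_def sym)
  moreover have "t \<bullet> (S' *\<^sub>v t) \<ge> 0" if t: "t \<in> carrier_vec n" for t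
  proof -
    define q where "q = (S *\<^sub>v t) $ i"
    have q: "q = (\<Sum>a = 0..<n. S $$ (a,i) * t $ a)"
      using SC t i by (auto simp: q_def scalar_prod_def sym intro!: sum.cong)
    have S't: "(S' *\<^sub>v t) $ a = (S *\<^sub>v t) $ a - S $$ (a,i) / S $$ (i,i) * q" if a: "a < n" for a
      using SC t i a unfolding q sum_distrib_left
      by (auto simp: S'_def scalar_prod_def sum_subtractf[symmetric] algebra_simps intro!: sum.cong)
    have "dim_vec (S' *\<^sub>v t) = n" by (simp add: S'_def)
    then have "t \<bullet> (S' *\<^sub>v t) = (\<Sum>a = 0..<n. t $ a * (S' *\<^sub>v t) $ a)"
      by (simp only: scalar_prod_def)
    moreover have "\<dots> = (\<Sum>a = 0..<n. t $ a * (S *\<^sub>v t) $ a - q / S $$ (i,i) * (S $$ (a,i) * t $ a))"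
      by (intro sum.cong refl) (simp add: S't algebra_simps del: index_mult_mat_vec)
    ultimately have "t \<bullet> (S' *\<^sub>v t) = (\<Sum>a = 0..<n. t $ a * (S *\<^sub>v t) $ a - q / S $$ (i,i) * (S $$ (a,i) * t $ a))"
      by (simp only:)
    also have "\<dots> = t \<bullet> (S *\<^sub>v t) - q / S $$ (i,i) * q"
      using SC unfolding sum_subtractf sum_distrib_left[symmetric] q[symmetric] by (simp add: scalar_prod_def)
    \<comment> \<open>The minimising shift is \<open>x = - q / S\<^sub>i\<^sub>i\<close>.\<close>
    also have "\<dots> = t \<bullet> (S *\<^sub>v t) + 2 * (- q / S $$ (i,i)) * q + (- q / S $$ (i,i))\<^sup>2 * S $$ (i,i)"
      using s by (simp add: power2_eq_square field_simps)
    also have "\<dots> \<ge> 0"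
      using pos[of "t + (- q / S $$ (i,i)) \<cdot>\<^sub>v unit_vec n i"]
      unfolding quadratic_form_shift[OF SC t i] q_def using t by simp
    finally show ?thesis .
  qed
  ultimately show ?thesis by (auto simp: psd_mat_def S'_def)
qed

text \<open>Cholesky factorisation of a possibly singular matrix. The rows with index less than \<open>i\<close>
  are already eliminated. A zero pivot contributes no column; a positive pivot contributes one column
  which is non-zero in row \<open>i\<close>, where all later columns vanish. This echelon shape makes the factor
  injective, so the number of columns produced is the rank.\<close>
lemma psd_factor_aux:
  assumes "psd_mat n S" "\<And>a b. a < i \<Longrightarrow> b < n \<Longrightarrow> S $$ (a,b) = 0" "i \<le> n"
  shows "\<exists>m B. B \<in> carrier_mat n m \<and> S = B * B\<^sup>T \<and>
           (\<forall>v\<in>carrier_vec m. B *\<^sub>v v = 0\<^sub>v n \<longrightarrow> v = 0\<^sub>v m)"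
  using assms
proof (induction "n - i" arbitrary: i S)
  case 0
  have "S = 0\<^sub>m n 0 * (0\<^sub>m n 0)\<^sup>T"
    using 0 by (intro eq_matI) (auto simp: psd_mat_def scalar_prod_def)
  then show ?case by (intro exI[of _ 0] exI[of _ "0\<^sub>m n 0"]) auto
next
  case (Suc d)
  have i: "i < n" and d: "d = n - Suc i" using Suc.hyps(2) by auto
  have SC: "S \<in> carrier_mat n n" "S\<^sup>T = S" and pos: "\<And>t. t \<in> carrier_vec n \<Longrightarrow> t \<bullet> (S *\<^sub>v t) \<ge> 0"
    using Suc.prems by (auto simp: psd_mat_def)
  have sym: "S $$ (a,b) = S $$ (b,a)" if "a < n" "b < n" for a b
    using SC that by (metis carrier_matD index_transpose_mat(1))
  have "unit_vec n i \<bullet> (S *\<^sub>v unit_vec n i) = S $$ (i,i)"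
    using SC i by (simp add: mult_mat_unit_vec)
  then have "S $$ (i,i) \<ge> 0" using pos[of "unit_vec n i"] by simp
  show ?case
  proof (cases "S $$ (i,i) = 0")
    case True
    then have "S $$ (a,b) = 0" if "a < Suc i" "b < n" for a b
      using that Suc.prems psd_zero_diag_zero_row[OF Suc.prems(1) i _ True] by (cases "a = i") auto
    then show ?thesis using Suc.hyps(1)[OF d Suc.prems(1)] i by auto
  next
    case False
    with \<open>S $$ (i,i) \<ge> 0\<close> have s: "S $$ (i,i) > 0" by simp
    define S' where "S' = mat n n (\<lambda>(a,b). S $$ (a,b) - S $$ (a,i) * S $$ (b,i) / S $$ (i,i))"
    have S': "psd_mat n S'" unfolding S'_def by (rule psd_deflate[OF Suc.prems(1) i s])
    have zero: "S' $$ (a,b) = 0" if "a < Suc i" "b < n" for a b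
    proof (cases "a = i")
      case True
      then show ?thesis using s i that sym by (simp add: S'_def)
    next
      case False
      then show ?thesis using i that Suc.prems(2) by (simp add: S'_def)
    qed
    obtain m B where B: "B \<in> carrier_mat n m" and SB: "S' = B * B\<^sup>T"
      and inj: "\<And>v. v \<in> carrier_vec m \<Longrightarrow> B *\<^sub>v v = 0\<^sub>v n \<Longrightarrow> v = 0\<^sub>v m"
      using Suc.hyps(1)[OF d S' zero] i by auto
    have entry: "S' $$ (a,b) = (\<Sum>c = 0..<m. B $$ (a,c) * B $$ (b,c))" if "a < n" "b < n" for a b
      using that B unfolding SB by (simp add: scalar_prod_def)
    \<comment> \<open>A vanishing diagonal entry of \<open>B B\<^sup>T\<close> is the squared length of a row of \<open>B\<close>.\<close>
    have "(\<Sum>c = 0..<m. (B $$ (i,c))\<^sup>2) = 0"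
      using entry[of i i] zero[of i i] i by (simp add: power2_eq_square)
    then have Bi: "B $$ (i,c) = 0" if "c < m" for c
      using that by (subst (asm) sum_nonneg_eq_0_iff) auto
    define C where "C = mat n (Suc m) (\<lambda>(a,c). if c = 0 then S $$ (a,i) / sqrt (S $$ (i,i)) else B $$ (a,c-1))"
    have C: "C \<in> carrier_mat n (Suc m)" by (simp add: C_def)
    have "S = C * C\<^sup>T"
    proof (rule eq_matI)
      fix a b assume "a < dim_row (C * C\<^sup>T)" "b < dim_col (C * C\<^sup>T)"
      then have ab: "a < n" "b < n" by (auto simp: C_def)
      have "(C * C\<^sup>T) $$ (a,b) = (\<Sum>c = 0..<Suc m. C $$ (a,c) * C $$ (b,c))"
        using ab C by (simp add: scalar_prod_def del: sum.op_ivl_Suc)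
      also have "\<dots> = C $$ (a,0) * C $$ (b,0) + (\<Sum>c = 0..<m. C $$ (a,Suc c) * C $$ (b,Suc c))"
        by (subst sum.atLeast0_lessThan_Suc_shift) (simp add: o_def)
      also have "(\<Sum>c = 0..<m. C $$ (a,Suc c) * C $$ (b,Suc c)) = S' $$ (a,b)"
        unfolding entry[OF ab] using ab by (auto simp: C_def intro!: sum.cong)
      also have "C $$ (a,0) * C $$ (b,0) = S $$ (a,i) * S $$ (b,i) / S $$ (i,i)"
        using ab s by (simp add: C_def)
      finally show "S $$ (a,b) = (C * C\<^sup>T) $$ (a,b)" using ab by (simp add: S'_def)
    qed (use SC in \<open>auto simp: C_def\<close>)
    moreover have "v = 0\<^sub>v (Suc m)" if v: "v \<in> carrier_vec (Suc m)" and 0: "C *\<^sub>v v = 0\<^sub>v n" for v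
    proof -
      have row: "C $$ (a,0) * v $ 0 + (\<Sum>c = 0..<m. B $$ (a,c) * v $ Suc c) = 0" if a: "a < n" for a
      proof -
        have "(C *\<^sub>v v) $ a = (\<Sum>c = 0..<Suc m. C $$ (a,c) * v $ c)"
          using a C v by (simp add: scalar_prod_def del: sum.op_ivl_Suc)
        also have "\<dots> = C $$ (a,0) * v $ 0 + (\<Sum>c = 0..<m. C $$ (a,Suc c) * v $ Suc c)"
          by (subst sum.atLeast0_lessThan_Suc_shift) (simp add: o_def)
        also have "(\<Sum>c = 0..<m. C $$ (a,Suc c) * v $ Suc c) = (\<Sum>c = 0..<m. B $$ (a,c) * v $ Suc c)"
          using a by (auto simp: C_def intro!: sum.cong)
        finally show ?thesis using 0 a by simp
      qed
      have v0: "v $ 0 = 0" using row[OF i] Bi s i by (simp add: C_def)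
      have "B *\<^sub>v vec m (\<lambda>c. v $ Suc c) = 0\<^sub>v n"
        using B row v0 by (intro eq_vecI) (auto simp: scalar_prod_def)
      then have "vec m (\<lambda>c. v $ Suc c) = 0\<^sub>v m" by (intro inj) auto
      then have "v $ Suc c = 0" if "c < m" for c using that by (metis index_vec index_zero_vec(1))
      then show ?thesis using v v0 by (intro eq_vecI) (auto simp: less_Suc_eq_0_disj)
    qed
    ultimately show ?thesis using C by blast
  qed
qed

lemma psd_factor:
  assumes S: "psd_mat n S"
  obtains B where "B \<in> carrier_mat n (vec_space.rank n S)" "S = B * B\<^sup>T"
    "vec_space.rank n B = vec_space.rank n S"
proof -
  obtain m B where B: "B \<in> carrier_mat n m" "S = B * B\<^sup>T"
     "\<forall>v\<in>carrier_vec m. B *\<^sub>v v = 0\<^sub>v n \<longrightarrow> v = 0\<^sub>v m"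
    using psd_factor_aux[OF S, of 0] by auto
  have rk: "vec_space.rank n B = m" using full_column_rank_iff_injective[OF B(1)] B(3) by simp
  have "vec_space.rank n S = m" using rank_mult_transpose[OF B(1) rk] B(2) by simp
  with B rk that show thesis by metis
qed

text \<open>The matrix is the Householder reflection along \<open>(1, x, x\<^sup>2, \<dots>)\<close>. If its \<open>l\<close>-th column lies on the
  line through \<open>w\<close>, the ratio of two of its entries equals that of \<open>w\<close>, which says that \<open>x\<close> is a root
  of a fixed polynomial. It is non-zero because the coefficient of \<open>x\<^sup>2\<^sup>b\<close> is \<open>1\<close>, where \<open>b \<noteq> l\<close> is the
  row of the second entry. Hence all but finitely many \<open>x\<close> avoid all the given lines. Two different
  entries are compared, which is where \<open>r \<ge> 2\<close> enters.\<close>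
lemma orthogonal_columns_avoiding_lines:
  fixes W :: "real vec set"
  assumes r: "r \<ge> 2" and W: "finite W"
  obtains H where "H \<in> carrier_mat r r" "H * H\<^sup>T = 1\<^sub>m r"
    "\<And>l w c. l < r \<Longrightarrow> w \<in> W \<Longrightarrow> w \<in> carrier_vec r \<Longrightarrow> col H l \<noteq> c \<cdot>\<^sub>v w"
proof -
  define other :: "nat \<Rightarrow> nat" where "other l = (if l = 0 then 1 else 0)" for l
  \<comment> \<open>The \<open>l\<close>-th column has entries \<open>1 - 2 x\<^sup>2\<^sup>l / N\<close> in row \<open>l\<close> and \<open>- 2 x\<^sup>l\<^sup>+\<^sup>b / N\<close> in row \<open>b = other l\<close>,
     where \<open>N = 1 + x\<^sup>2 + x\<^sup>4 + \<dots>\<close>; \<open>P l w\<close> is \<open>N\<close> times the first entry minus \<open>w\<^sub>l / w\<^sub>b\<close> times the second.\<close>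
  define P where "P l w = (\<Sum>a<r. monom 1 (2 * a)) - monom 2 (2 * l)
      + monom (2 * (w $ l / w $ other l)) (l + other l)" for l :: nat and w :: "real vec"
  have "coeff (P l w) (2 * other l) = 1" if "l < r" for l w
    using r that unfolding P_def by (simp add: coeff_sum other_def)
  then have "P l w \<noteq> 0" if "l < r" for l w using that by (metis coeff_0 zero_neq_one)
  then have "finite (\<Union>l<r. \<Union>w\<in>W. {x. poly (P l w) x = 0})"
    using W by (intro finite_UN_I) (auto intro: poly_roots_finite)
  \<comment> \<open>The value \<open>0\<close> is excluded as well, since there the columns are coordinate vectors
     up to sign.\<close>
  then have "finite (insert 0 (\<Union>l<r. \<Union>w\<in>W. {x. poly (P l w) x = 0}))" by simp
  then obtain x where "x \<notin> insert 0 (\<Union>l<r. \<Union>w\<in>W. {x. poly (P l w) x = 0})"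
    using ex_new_if_finite[OF infinite_UNIV_char_0] by blast
  then have x: "x \<noteq> 0" "\<And>l w. l < r \<Longrightarrow> w \<in> W \<Longrightarrow> poly (P l w) x \<noteq> 0" by auto
  define N where "N = (\<Sum>a<r. x ^ (2 * a))"
  have "N > 0" unfolding N_def using r x
    by (intro sum_pos) (auto simp: zero_less_power_eq lessThan_empty_iff)
  define h where "h a b = (if a = b then 1 else 0) - 2 * x ^ a * x ^ b / N" for a b
  define H where "H = mat r r (\<lambda>(a,b). h a b)"
  have H: "H \<in> carrier_mat r r" by (simp add: H_def)
  have "H * H\<^sup>T = 1\<^sub>m r"
  proof (rule eq_matI)
    fix a b assume "a < dim_row (1\<^sub>m r :: real mat)" "b < dim_col (1\<^sub>m r :: real mat)"
    then have ab: "a < r" "b < r" by auto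
    have "(H * H\<^sup>T) $$ (a,b) = (\<Sum>c<r. h a c * h b c)"
      using ab by (simp add: H_def scalar_prod_def lessThan_atLeast0)
    also have "\<dots> = (\<Sum>c<r. (if a = c then (if b = c then 1 else 0) else 0)
        - (if a = c then 2 * x ^ b * x ^ c / N else 0) - (if b = c then 2 * x ^ a * x ^ c / N else 0)
        + 4 * x ^ a * x ^ b / N\<^sup>2 * x ^ (2 * c))"
      by (intro sum.cong) (auto simp: h_def algebra_simps power2_eq_square power_mult)
    also have "\<dots> = (if a = b then 1 else 0) - 2 * x ^ b * x ^ a / N - 2 * x ^ a * x ^ b / N
        + 4 * x ^ a * x ^ b / N\<^sup>2 * N"
      unfolding sum.distrib sum_subtractf sum_distrib_left[symmetric] N_def[symmetric] using ab by auto
    also have "\<dots> = (if a = b then 1 else 0)" using \<open>N > 0\<close> by (simp add: power2_eq_square field_simps)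
    finally show "(H * H\<^sup>T) $$ (a,b) = 1\<^sub>m r $$ (a,b)" using ab by simp
  qed (auto simp: H_def)
  moreover have False if l: "l < r" and w: "w \<in> W" "w \<in> carrier_vec r" and eq: "col H l = c \<cdot>\<^sub>v w" for l w c
  proof -
    let ?b = "other l"
    have b: "?b < r" "?b \<noteq> l" using r l by (auto simp: other_def)
    have "h i l = c * w $ i" if "i < r" for i
    proof -
      have "h i l = col H l $ i" using that l by (simp add: H_def)
      also have "\<dots> = c * w $ i" unfolding eq using that w by simp
      finally show ?thesis .
    qed
    then have entries: "h l l = c * w $ l" "h ?b l = c * w $ ?b" using l b by auto
    have "h ?b l \<noteq> 0" using b x \<open>N > 0\<close> by (simp add: h_def)
    with entries have "c \<noteq> 0" "w $ ?b \<noteq> 0" by auto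
    then have "h l l = w $ l / w $ ?b * h ?b l" using entries by simp
    then have "N * h l l = w $ l / w $ ?b * (N * h ?b l)" by simp
    moreover have "N * h l l = N - 2 * x ^ (2 * l)"
      using \<open>N > 0\<close> power_add[of x l l] by (simp add: h_def right_diff_distrib mult_2[symmetric])
    moreover have "N * h ?b l = - 2 * x ^ (l + ?b)"
      using \<open>N > 0\<close> b by (simp add: h_def power_add)
    ultimately have "poly (P l w) x = 0"
      by (simp add: P_def poly_sum poly_monom N_def)
    with x(2)[OF l w(1)] show False by simp
  qed
  ultimately show thesis using that[OF H] by blast
qed

text \<open>Right multiplication by an orthogonal matrix preserves \<open>B B\<^sup>T\<close> and the rank. With a left inverse
  \<open>L\<close> of \<open>B\<close>, a column \<open>B h\<close> can be proportional to \<open>a\<close> only if \<open>h\<close> is proportional to \<open>L a\<close>, so only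
  finitely many lines have to be avoided by the columns of the orthogonal matrix.\<close>
lemma rotate_factor_off_columns:
  fixes B A :: "real mat"
  assumes B: "B \<in> carrier_mat p r" "vec_space.rank p B = r" and A: "A \<in> carrier_mat p k" and r: "r \<ge> 2"
  obtains C where "C \<in> carrier_mat p r" "vec_space.rank p C = r" "C * C\<^sup>T = B * B\<^sup>T"
    "\<And>l j. l < r \<Longrightarrow> j < k \<Longrightarrow> \<not> proportional (col C l) (col A j)"
proof -
  obtain L where L: "L \<in> carrier_mat r p" "L * B = 1\<^sub>m r"
    using injective_left_inverse[OF B(1)] full_column_rank_iff_injective[OF B(1)] B(2) by metis
  obtain H where H: "H \<in> carrier_mat r r" "H * H\<^sup>T = 1\<^sub>m r"
    and avoid: "\<And>l w c. l < r \<Longrightarrow> w \<in> (\<lambda>j. L *\<^sub>v col A j) ` {..<k} \<Longrightarrow> w \<in> carrier_vec r \<Longrightarrow> col H l \<noteq> c \<cdot>\<^sub>v w"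
    using orthogonal_columns_avoiding_lines[OF r, of "(\<lambda>j. L *\<^sub>v col A j) ` {..<k}"] by blast
  have H': "H\<^sup>T * H = 1\<^sub>m r" using mat_mult_left_right_inverse[OF H(1) _ H(2)] H(1) by simp
  define C where "C = B * H"
  have C: "C \<in> carrier_mat p r" using B H by (simp add: C_def)
  have CC: "C * C\<^sup>T = B * B\<^sup>T"
  proof -
    have "C * C\<^sup>T = B * H * (H\<^sup>T * B\<^sup>T)" using B H by (simp add: C_def transpose_mult)
    also have "\<dots> = B * (H * (H\<^sup>T * B\<^sup>T))" using B H(1) by (intro assoc_mult_mat) auto
    also have "H * (H\<^sup>T * B\<^sup>T) = H * H\<^sup>T * B\<^sup>T" using B H(1) by (intro assoc_mult_mat[symmetric]) auto
    finally show ?thesis using B H by simp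
  qed
  have "L * C = L * B * H" unfolding C_def
    by (rule assoc_mult_mat[symmetric, OF L(1) B(1) H(1)])
  then have LC: "L * C = H" using L H by simp
  have "v = 0\<^sub>v r" if v: "v \<in> carrier_vec r" "C *\<^sub>v v = 0\<^sub>v p" for v
  proof -
    have "H *\<^sub>v v = L *\<^sub>v (C *\<^sub>v v)" using L C v LC by (metis assoc_mult_mat_vec)
    also have "\<dots> = 0\<^sub>v r" using v L by (auto simp: mult_mat_vec_def intro!: eq_vecI)
    finally have "H\<^sup>T *\<^sub>v (H *\<^sub>v v) = 0\<^sub>v r" using H by (auto intro!: eq_vecI)
    then show ?thesis using H H' v by (metis assoc_mult_mat_vec one_mult_mat_vec transpose_carrier_mat)
  qed
  then have rk: "vec_space.rank p C = r" using full_column_rank_iff_injective[OF C] by blast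
  have "\<not> proportional (col C l) (col A j)" if "l < r" "j < k" for l j
  proof
    assume "proportional (col C l) (col A j)"
    then obtain c where "col C l = c \<cdot>\<^sub>v col A j" by (auto simp: proportional_def)
    then have "L *\<^sub>v col C l = c \<cdot>\<^sub>v (L *\<^sub>v col A j)"
      using L A that by (simp add: mult_mat_vec)
    moreover have "L *\<^sub>v col C l = col H l" using LC L C that by (metis carrier_matD(2) col_mult2)
    ultimately show False using avoid[of l "L *\<^sub>v col A j" c] that L A by auto
  qed
  then show thesis using that C rk CC by blast
qed

section \<open>Gaussian vectors\<close>

lemma vec_borel_component_measurable [measurable]:
  "i < n \<Longrightarrow> (\<lambda>v. v $ i) \<in> borel_measurable (vec_borel n)"
  using measurable_vec_borel_iff[of "\<lambda>v. v" "vec_borel n" n] by simp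

lemma affine_measurable_vec_borel:
  fixes D :: "real mat"
  assumes D: "D \<in> carrier_mat q n" and d: "d \<in> carrier_vec q"
  shows "(\<lambda>v. D *\<^sub>v v + d) \<in> vec_borel n \<rightarrow>\<^sub>M vec_borel q"
  unfolding measurable_vec_borel_iff
proof (intro conjI ballI allI impI)
  show "D *\<^sub>v v + d \<in> carrier_vec q" if "v \<in> space (vec_borel n)" for v using D d that by auto
  fix i assume i: "i < q"
  have "(\<lambda>v. (\<Sum>j = 0..<n. D $$ (i,j) * v $ j) + d $ i) \<in> borel_measurable (vec_borel n)"
    by (intro borel_measurable_add borel_measurable_sum borel_measurable_times) auto
  also have "?this \<longleftrightarrow> (\<lambda>v. (D *\<^sub>v v + d) $ i) \<in> borel_measurable (vec_borel n)"
    using D d i by (intro measurable_cong) (auto simp: scalar_prod_def)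
  finally show "(\<lambda>v. (D *\<^sub>v v + d) $ i) \<in> borel_measurable (vec_borel n)" .
qed

lemma transpose_scalar_prod:
  fixes D :: "real mat"
  assumes "D \<in> carrier_mat q n" "t \<in> carrier_vec q" "v \<in> carrier_vec n"
  shows "t \<bullet> (D *\<^sub>v v) = (D\<^sup>T *\<^sub>v t) \<bullet> v"
  using transpose_vec_mult_scalar[OF assms(1,3,2)] by simp

lemma psd_mat_congruence:
  assumes S: "psd_mat n S" and D: "D \<in> carrier_mat q n"
  shows "psd_mat q (D * S * D\<^sup>T)"
    and "t \<in> carrier_vec q \<Longrightarrow> t \<bullet> ((D * S * D\<^sup>T) *\<^sub>v t) = (D\<^sup>T *\<^sub>v t) \<bullet> (S *\<^sub>v (D\<^sup>T *\<^sub>v t))"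
proof -
  have SC: "S \<in> carrier_mat n n" "S\<^sup>T = S" and pos: "\<And>t. t \<in> carrier_vec n \<Longrightarrow> t \<bullet> (S *\<^sub>v t) \<ge> 0"
    using S by (auto simp: psd_mat_def)
  have quad: "t \<bullet> ((D * S * D\<^sup>T) *\<^sub>v t) = (D\<^sup>T *\<^sub>v t) \<bullet> (S *\<^sub>v (D\<^sup>T *\<^sub>v t))" if t: "t \<in> carrier_vec q" for t
  proof -
    have "(D * S * D\<^sup>T) *\<^sub>v t = (D * S) *\<^sub>v (D\<^sup>T *\<^sub>v t)"
      using D SC t by (intro assoc_mult_mat_vec) auto
    also have "\<dots> = D *\<^sub>v (S *\<^sub>v (D\<^sup>T *\<^sub>v t))"
      using D SC t by (intro assoc_mult_mat_vec) auto
    finally show ?thesis using D SC t by (simp add: transpose_scalar_prod[of D q n])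
  qed
  have "(D * S * D\<^sup>T)\<^sup>T = D * (D * S)\<^sup>T"
    using D SC by (subst transpose_mult[of _ q n _ q]) auto
  also have "\<dots> = D * (S * D\<^sup>T)"
    using D SC by (subst transpose_mult[of _ q n _ n]) auto
  also have "\<dots> = D * S * D\<^sup>T" using D SC by (intro assoc_mult_mat[symmetric]) auto
  finally show "psd_mat q (D * S * D\<^sup>T)"
    using D SC pos quad unfolding psd_mat_def by auto
  show "t \<in> carrier_vec q \<Longrightarrow> t \<bullet> ((D * S * D\<^sup>T) *\<^sub>v t) = (D\<^sup>T *\<^sub>v t) \<bullet> (S *\<^sub>v (D\<^sup>T *\<^sub>v t))"
    by (rule quad)
qed

lemma gaussian_vec_affine_image:
  assumes E: "gaussian_vec M n E m S" and D: "D \<in> carrier_mat q n" and d: "d \<in> carrier_vec q"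
    and W: "\<And>\<omega>. \<omega> \<in> space M \<Longrightarrow> W \<omega> = D *\<^sub>v E \<omega> + d"
  shows "gaussian_vec M q W (D *\<^sub>v m + d) (D * S * D\<^sup>T)"
proof -
  have EM: "E \<in> M \<rightarrow>\<^sub>M vec_borel n" and m: "m \<in> carrier_vec n" and S: "psd_mat n S"
    and ch: "\<And>t. t \<in> carrier_vec n \<Longrightarrow> (CLINT \<omega>|M. iexp (t \<bullet> E \<omega>)) =
          exp (\<i> * complex_of_real (t \<bullet> m) - complex_of_real (t \<bullet> (S *\<^sub>v t)) / 2)"
    using E by (auto simp: gaussian_vec_def)
  have Ec: "E \<omega> \<in> carrier_vec n" if "\<omega> \<in> space M" for \<omega>
    using measurable_space[OF EM that] by simp
  have "(\<lambda>\<omega>. D *\<^sub>v E \<omega> + d) \<in> M \<rightarrow>\<^sub>M vec_borel q"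
    by (rule measurable_compose[OF EM affine_measurable_vec_borel[OF D d]])
  then have "W \<in> M \<rightarrow>\<^sub>M vec_borel q" using W by (simp cong: measurable_cong)
  moreover have "(CLINT \<omega>|M. iexp (t \<bullet> W \<omega>)) =
      exp (\<i> * complex_of_real (t \<bullet> (D *\<^sub>v m + d)) - complex_of_real (t \<bullet> ((D * S * D\<^sup>T) *\<^sub>v t)) / 2)"
    if t: "t \<in> carrier_vec q" for t
  proof -
    have dot: "t \<bullet> (D *\<^sub>v v + d) = (D\<^sup>T *\<^sub>v t) \<bullet> v + t \<bullet> d" if "v \<in> carrier_vec n" for v
      using D d t that by (simp add: scalar_prod_add_distrib[of _ q] transpose_scalar_prod[of D q n])
    have "(CLINT \<omega>|M. iexp (t \<bullet> W \<omega>)) = (CLINT \<omega>|M. iexp ((D\<^sup>T *\<^sub>v t) \<bullet> E \<omega>) * iexp (t \<bullet> d))"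
      using W Ec dot by (intro Bochner_Integration.integral_cong) (auto simp: exp_add distrib_left)
    also have "\<dots> = (CLINT \<omega>|M. iexp ((D\<^sup>T *\<^sub>v t) \<bullet> E \<omega>)) * iexp (t \<bullet> d)"
      by (rule integral_mult_left_zero)
    also have "\<dots> = exp (\<i> * complex_of_real (t \<bullet> (D *\<^sub>v m + d)) -
        complex_of_real ((D\<^sup>T *\<^sub>v t) \<bullet> (S *\<^sub>v (D\<^sup>T *\<^sub>v t))) / 2)"
      using D t m by (subst ch) (auto simp: dot exp_add[symmetric] algebra_simps)
    finally show ?thesis by (simp only: psd_mat_congruence(2)[OF S D t])
  qed
  ultimately show ?thesis
    using m d D psd_mat_congruence(1)[OF S D] by (auto simp: gaussian_vec_def)
qed

lemma gaussian_vec_component_char: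
  assumes E: "gaussian_vec M n E m S" and i: "i < n"
  shows "char (distr M borel (\<lambda>\<omega>. E \<omega> $ i)) s =
      exp (\<i> * complex_of_real (s * m $ i) - complex_of_real (S $$ (i,i) * s\<^sup>2) / 2)"
    and "S $$ (i,i) \<ge> 0"
    and "(\<lambda>\<omega>. E \<omega> $ i) \<in> borel_measurable M"
proof -
  have EM: "E \<in> M \<rightarrow>\<^sub>M vec_borel n" and m: "m \<in> carrier_vec n" and S: "psd_mat n S"
    and ch: "\<And>t. t \<in> carrier_vec n \<Longrightarrow> (CLINT \<omega>|M. iexp (t \<bullet> E \<omega>)) =
          exp (\<i> * complex_of_real (t \<bullet> m) - complex_of_real (t \<bullet> (S *\<^sub>v t)) / 2)"
    using E by (auto simp: gaussian_vec_def)
  show Ei [measurable]: "(\<lambda>\<omega>. E \<omega> $ i) \<in> borel_measurable M"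
    using EM i by (simp add: measurable_vec_borel_iff)
  have SC: "S \<in> carrier_mat n n" and pos: "\<And>t. t \<in> carrier_vec n \<Longrightarrow> t \<bullet> (S *\<^sub>v t) \<ge> 0"
    using S by (auto simp: psd_mat_def)
  have quad: "(s \<cdot>\<^sub>v unit_vec n i) \<bullet> (S *\<^sub>v (s \<cdot>\<^sub>v unit_vec n i)) = S $$ (i,i) * s\<^sup>2" for s
    using SC i by (simp add: mult_mat_vec mult_mat_unit_vec smult_scalar_prod_distrib[of _ n]
        scalar_prod_smult_distrib[of _ n] power2_eq_square)
  show "S $$ (i,i) \<ge> 0" using pos[of "1 \<cdot>\<^sub>v unit_vec n i"] quad[of 1] by simp
  have dot: "(s \<cdot>\<^sub>v unit_vec n i) \<bullet> v = s * v $ i" if "v \<in> carrier_vec n" for v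
    using that i by (simp add: smult_scalar_prod_distrib[of _ n])
  have "char (distr M borel (\<lambda>\<omega>. E \<omega> $ i)) s = (CLINT \<omega>|M. iexp (s * E \<omega> $ i))"
    unfolding char_def by (subst integral_distr) auto
  also have "\<dots> = (CLINT \<omega>|M. iexp ((s \<cdot>\<^sub>v unit_vec n i) \<bullet> E \<omega>))"
    using measurable_space[OF EM]
    by (intro Bochner_Integration.integral_cong refl) (simp only: dot space_vec_borel)
  also have "\<dots> = exp (\<i> * complex_of_real (s * m $ i) - complex_of_real (S $$ (i,i) * s\<^sup>2) / 2)"
    by (subst ch) (simp_all only: dot[OF m] quad smult_carrier_vec unit_vec_carrier)
  finally show "char (distr M borel (\<lambda>\<omega>. E \<omega> $ i)) s = \<dots>" .
qed

lemma char_return: "char (return borel c) t = iexp (t * c)"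
  unfolding char_def by (subst integral_return) auto

text \<open>Every component has the characteristic function \<open>1\<close> of the Dirac measure at \<open>0\<close>.\<close>
lemma (in prob_space) gaussian_vec_zero_cov_AE:
  assumes W: "gaussian_vec M n W (0\<^sub>v n) (0\<^sub>m n n)"
  shows "AE \<omega> in M. W \<omega> = 0\<^sub>v n"
proof -
  have WM: "W \<in> M \<rightarrow>\<^sub>M vec_borel n" using W by (simp add: gaussian_vec_def)
  have "AE \<omega> in M. \<forall>i\<in>{..<n}. W \<omega> $ i = 0"
  proof (rule AE_finite_allI)
    fix i assume "i \<in> {..<n}"
    then have i: "i < n" by simp
    note comp = gaussian_vec_component_char[OF W i]
    note [measurable] = comp(3)
    interpret D: real_distribution "distr M borel (\<lambda>\<omega>. W \<omega> $ i)" by (rule real_distribution_distr) (rule comp(3))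
    interpret R: real_distribution "return borel (0::real)"
      by (intro real_distribution.intro prob_space_return real_distribution_axioms.intro) auto
    have "char (distr M borel (\<lambda>\<omega>. W \<omega> $ i)) = char (return borel 0)"
      using i by (intro ext) (simp add: comp(1) char_return)
    then have "distr M borel (\<lambda>\<omega>. W \<omega> $ i) = return borel 0"
      by (intro Levy_uniqueness D.real_distribution_axioms R.real_distribution_axioms)
    moreover have "AE x in return borel (0::real). x = 0" by (subst AE_return) auto
    ultimately have "AE x in distr M borel (\<lambda>\<omega>. W \<omega> $ i). x = 0" by (simp only:)
    then show "AE \<omega> in M. W \<omega> $ i = 0" by (subst (asm) AE_distr_iff) auto
  qed simp
  then show ?thesis
    using measurable_space[OF WM] by (auto intro!: AE_I2 eq_vecI elim!: eventually_rev_mp)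
qed

lemma (in prob_space) standard_gaussian_components_indep:
  assumes V: "gaussian_vec M r V (0\<^sub>v r) (1\<^sub>m r)"
  shows "indep_vars (\<lambda>_. borel) (\<lambda>l \<omega>. V \<omega> $ l) {..<r}"
proof (rule indep_vars_if_char_factorises)
  note comp = gaussian_vec_component_char[OF V]
  show Vm: "(\<lambda>\<omega>. V \<omega> $ i) \<in> borel_measurable M" if "i \<in> {..<r}" for i using comp(3) that by simp
  have VM: "V \<in> M \<rightarrow>\<^sub>M vec_borel r" using V by (simp add: gaussian_vec_def)
  fix t :: "nat \<Rightarrow> real"
  have c: "(CLINT \<omega>|M. iexp (t i * V \<omega> $ i)) = exp (- complex_of_real ((t i)\<^sup>2) / 2)" if "i < r" for i
  proof -
    have "(CLINT \<omega>|M. iexp (t i * V \<omega> $ i)) = char (distr M borel (\<lambda>\<omega>. V \<omega> $ i)) (t i)"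
      unfolding char_def using Vm[of i] that by (subst integral_distr) auto
    then show ?thesis using that by (simp add: comp(1))
  qed
  have "(CLINT \<omega>|M. \<Prod>i<r. iexp (t i * V \<omega> $ i)) = (CLINT \<omega>|M. iexp (vec r t \<bullet> V \<omega>))"
  proof (rule Bochner_Integration.integral_cong[OF refl])
    fix \<omega> assume "\<omega> \<in> space M"
    then have "vec r t \<bullet> V \<omega> = (\<Sum>i<r. t i * V \<omega> $ i)"
      using measurable_space[OF VM, of \<omega>] by (auto simp: scalar_prod_def lessThan_atLeast0)
    then show "(\<Prod>i<r. iexp (t i * V \<omega> $ i)) = iexp (vec r t \<bullet> V \<omega>)"
      by (simp add: exp_sum sum_distrib_left)
  qed
  also have "\<dots> = exp (- complex_of_real (\<Sum>i<r. (t i)\<^sup>2) / 2)"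
    using V unfolding gaussian_vec_def by (auto simp: scalar_prod_def lessThan_atLeast0 power2_eq_square)
  also have "\<dots> = (\<Prod>i<r. exp (- complex_of_real ((t i)\<^sup>2) / 2))"
    by (simp add: exp_sum[symmetric] sum_negf sum_divide_distrib)
  also have "\<dots> = (\<Prod>i<r. CLINT \<omega>|M. iexp (t i * V \<omega> $ i))"
    by (intro prod.cong refl c[symmetric]) simp
  finally show "(CLINT \<omega>|M. \<Prod>i<r. iexp (t i * V \<omega> $ i)) = \<dots>" .
qed simp

lemma (in prob_space) integrable_iexp_real:
  assumes [measurable]: "X \<in> borel_measurable M"
  shows "integrable M (\<lambda>\<omega>. iexp (s * X \<omega>))"
  by (intro integrable_const_bound[of _ 1]) auto

lemma prod_lessThan_add_split:
  fixes f :: "nat \<Rightarrow> 'a :: comm_monoid_mult"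
  shows "(\<Prod>i<k+r. f i) = (\<Prod>i<k. f i) * (\<Prod>l<r. f (k + l))"
  by (induction r) (simp_all add: mult.assoc)

text \<open>All scalar variables in play are put into a single independent family: the independence of the
  vectors \<open>Z\<close> and \<open>V\<close> splits the joint characteristic function into two factors, and the
  independence within each vector splits these further. Afterwards every independence
  statement is one about functions of disjoint blocks of this family.\<close>
lemma (in prob_space) indep_components_joint:
  assumes Z: "indep_vars (\<lambda>_. borel) (\<lambda>j \<omega>. Z \<omega> $ j) {..<k}"
    and V: "indep_vars (\<lambda>_. borel) (\<lambda>l \<omega>. V \<omega> $ l) {..<r}"
    and ZV: "indep_var (vec_borel k) Z (vec_borel r) V"
  shows "indep_vars (\<lambda>_. borel) (\<lambda>i \<omega>. if i < k then Z \<omega> $ i else V \<omega> $ (i - k) :: real) {..<k + r}"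
    (is "indep_vars _ ?U _")
proof (rule indep_vars_if_char_factorises)
  have m: "j < k \<Longrightarrow> (\<lambda>\<omega>. Z \<omega> $ j) \<in> borel_measurable M" "l < r \<Longrightarrow> (\<lambda>\<omega>. V \<omega> $ l) \<in> borel_measurable M" for j l
    using Z V by (auto simp: indep_vars_def)
  show "?U i \<in> borel_measurable M" if "i \<in> {..<k+r}" for i
    using m that by (cases "i < k") auto
  fix t :: "nat \<Rightarrow> real"
  define F where "F v = (\<Prod>j<k. iexp (t j * v $ j))" for v :: "real vec"
  define G where "G v = (\<Prod>l<r. iexp (t (k + l) * v $ l))" for v :: "real vec"
  have F: "F \<in> borel_measurable (vec_borel k)" and G: "G \<in> borel_measurable (vec_borel r)"
    unfolding F_def G_def by (intro borel_measurable_prod; measurable)+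
  have n1: "norm (F v) = 1" "norm (G v) = 1" for v by (simp_all add: F_def G_def flip: prod_norm)
  have FG: "indep_var borel (\<lambda>\<omega>. F (Z \<omega>)) borel (\<lambda>\<omega>. G (V \<omega>))"
    using indep_var_compose[OF ZV F G] by (simp add: o_def)
  have "(CLINT \<omega>|M. \<Prod>i<k+r. iexp (t i * ?U i \<omega>)) = (CLINT \<omega>|M. F (Z \<omega>) * G (V \<omega>))"
    by (simp add: prod_lessThan_add_split F_def G_def)
  also have "\<dots> = (CLINT \<omega>|M. F (Z \<omega>)) * (CLINT \<omega>|M. G (V \<omega>))"
    using FG n1 indep_var_rv1[OF FG] indep_var_rv2[OF FG]
    by (intro indep_var_lebesgue_integral integrable_const_bound[of _ 1]) auto
  also have "(CLINT \<omega>|M. F (Z \<omega>)) = (\<Prod>j<k. CLINT \<omega>|M. iexp (t j * Z \<omega> $ j))"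
    unfolding F_def
    by (intro indep_vars_lebesgue_integral indep_vars_compose2[OF Z] integrable_iexp_real m(1); measurable; simp)
  also have "(CLINT \<omega>|M. G (V \<omega>)) = (\<Prod>l<r. CLINT \<omega>|M. iexp (t (k + l) * V \<omega> $ l))"
    unfolding G_def
    by (intro indep_vars_lebesgue_integral indep_vars_compose2[OF V] integrable_iexp_real m(2); measurable; simp)
  also have "(\<Prod>j<k. CLINT \<omega>|M. iexp (t j * Z \<omega> $ j)) * \<dots> = (\<Prod>i<k+r. CLINT \<omega>|M. iexp (t i * ?U i \<omega>))"
    by (simp add: prod_lessThan_add_split)
  finally show "(CLINT \<omega>|M. \<Prod>i<k+r. iexp (t i * ?U i \<omega>)) = \<dots>" .
qed simp

text \<open>The equation defining \<open>T j\<close> is only required on \<open>space M\<close>, because vectors are only known to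
  have the right dimension there.\<close>
lemma (in prob_space) indep_vars_functions_of_blocks:
  assumes U: "indep_vars (\<lambda>_. borel) U I" and K: "\<And>j. j \<in> L \<Longrightarrow> K j \<subseteq> I" and disj: "disjoint_family_on K L"
    and f: "\<And>j. j \<in> L \<Longrightarrow> f j \<in> PiM (K j) (\<lambda>_. borel) \<rightarrow>\<^sub>M N j"
    and T: "\<And>j \<omega>. j \<in> L \<Longrightarrow> \<omega> \<in> space M \<Longrightarrow> T j \<omega> = f j (restrict (\<lambda>i. U i \<omega>) (K j))"
  shows "indep_vars N T L"
proof -
  have *: "indep_vars N (\<lambda>j \<omega>. f j (restrict (\<lambda>i. U i \<omega>) (K j))) L"
    by (rule indep_vars_compose2[OF indep_vars_restrict[OF U K disj] f])
  have eq: "{T j -` A \<inter> space M |A. A \<in> sets (N j)} =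
      {(\<lambda>\<omega>. f j (restrict (\<lambda>i. U i \<omega>) (K j))) -` A \<inter> space M |A. A \<in> sets (N j)}" if "j \<in> L" for j
  proof -
    have "T j -` A \<inter> space M = (\<lambda>\<omega>. f j (restrict (\<lambda>i. U i \<omega>) (K j))) -` A \<inter> space M" for A
      using T that by auto
    then show ?thesis by simp
  qed
  show ?thesis
    using * unfolding indep_vars_def2
    by (auto simp: eq T cong: measurable_cong indep_sets_cong)
qed

text \<open>The elementary relative of Cramer's theorem in which one summand is known to be Gaussian. Dividing
  characteristic functions gives \<open>Y\<close> the characteristic function of
  a Gaussian of variance \<open>u - v\<close>, and this variance is non-negative because characteristic functions are
  bounded by one.\<close>
lemma (in prob_space) gaussian_rv_summand:
  fixes Y W :: "'a \<Rightarrow> real"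
  assumes ind: "indep_var borel Y borel W"
    and W: "\<And>s. char (distr M borel W) s = exp (- complex_of_real (v * s\<^sup>2) / 2)"
    and sum: "gaussian_rv M (\<lambda>\<omega>. Y \<omega> + W \<omega>)"
  shows "gaussian_rv M Y"
proof -
  have Y: "Y \<in> borel_measurable M" using indep_var_rv1[OF ind] .
  interpret D: real_distribution "distr M borel Y" by (rule real_distribution_distr) (rule Y)
  obtain m u where c: "\<And>s. char (distr M borel (\<lambda>\<omega>. Y \<omega> + W \<omega>)) s =
        exp (\<i> * complex_of_real (s * m) - complex_of_real (u * s\<^sup>2) / 2)"
    using sum unfolding gaussian_rv_iff_char by blast
  have chY: "char (distr M borel Y) s = exp (\<i> * complex_of_real (s * m) - complex_of_real ((u - v) * s\<^sup>2) / 2)" for s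
  proof -
    have "char (distr M borel Y) s * exp (- complex_of_real (v * s\<^sup>2) / 2) =
        exp (\<i> * complex_of_real (s * m) - complex_of_real (u * s\<^sup>2) / 2)"
      using char_distr_add[OF ind, of s] c W by simp
    then have "char (distr M borel Y) s = exp (\<i> * complex_of_real (s * m) - complex_of_real (u * s\<^sup>2) / 2)
        / exp (- complex_of_real (v * s\<^sup>2) / 2)" by (simp add: field_simps)
    also have "\<dots> = exp (\<i> * complex_of_real (s * m) - complex_of_real ((u - v) * s\<^sup>2) / 2)"
      by (simp add: exp_diff[symmetric] field_simps)
    finally show ?thesis .
  qed
  have "norm (char (distr M borel Y) 1) \<le> 1" by (rule D.cmod_char_le_1)
  then have "u - v \<ge> 0" unfolding chY by (simp add: norm_exp_eq_Re)
  with Y chY show ?thesis unfolding gaussian_rv_iff_char by blast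
qed

lemma (in prob_space) non_gaussian_nonconstant:
  assumes Y: "Y \<in> borel_measurable M" and ng: "\<not> gaussian_rv M Y"
  shows "nonconstant_rv M Y"
  unfolding nonconstant_rv_def
proof (intro allI notI)
  fix c assume "distr M borel Y = return borel c"
  then have "gaussian_rv M Y"
    unfolding gaussian_rv_iff_char using Y char_return[of c]
    by (intro conjI exI[of _ c] exI[of _ 0]) auto
  with ng show False by simp
qed

lemma (in prob_space) standard_normal_nonconstant:
  assumes ch: "\<And>s. char (distr M borel Y) s = exp (- complex_of_real (s\<^sup>2) / 2)"
  shows "nonconstant_rv M Y"
  unfolding nonconstant_rv_def
proof (intro allI notI)
  fix c assume "distr M borel Y = return borel c"
  then have "norm (exp (- complex_of_real (1\<^sup>2) / 2)) = norm (iexp (1 * c))"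
    using ch[of 1] char_return[of c 1] by metis
  then show False by (simp add: norm_exp_eq_Re)
qed

lemma gram_congruence:
  fixes D :: "real mat"
  assumes D: "D \<in> carrier_mat q p" and B: "B \<in> carrier_mat p r"
  shows "D * (B * B\<^sup>T) * D\<^sup>T = D * B * (D * B)\<^sup>T"
proof -
  have "D * (B * B\<^sup>T) = D * B * B\<^sup>T" using D B by (intro assoc_mult_mat[symmetric]) auto
  then have "D * (B * B\<^sup>T) * D\<^sup>T = D * B * B\<^sup>T * D\<^sup>T" by (simp only:)
  also have "\<dots> = D * B * (B\<^sup>T * D\<^sup>T)" using D B by (intro assoc_mult_mat) auto
  finally show ?thesis using D B by (simp add: transpose_mult)
qed

text \<open>With a left inverse \<open>L\<close> of \<open>B\<close>, put \<open>V = L (E - \<mu>)\<close>. Its covariance is \<open>L B B\<^sup>T L\<^sup>T = I\<close>, and the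
  residual \<open>(I - B L) (E - \<mu>)\<close> has covariance zero because \<open>(I - B L) B = 0\<close>. Since \<open>V\<close> is a
  function of \<open>E\<close>, it inherits the independence of \<open>Z\<close>.\<close>
lemma (in prob_space) gaussian_factor_of_factorisation:
  assumes E: "gaussian_vec M p E \<mu> S" and ZE: "indep_var (vec_borel k) Z (vec_borel p) E"
    and B: "B \<in> carrier_mat p r" "vec_space.rank p B = r" and S: "S = B * B\<^sup>T"
  obtains V where "gaussian_factor M p k r Z E \<mu> S B V"
proof -
  obtain L where L: "L \<in> carrier_mat r p" "L * B = 1\<^sub>m r"
    using injective_left_inverse[OF B(1)] full_column_rank_iff_injective[OF B(1)] B(2) by metis
  have EM: "E \<in> M \<rightarrow>\<^sub>M vec_borel p" and \<mu>: "\<mu> \<in> carrier_vec p" using E by (auto simp: gaussian_vec_def)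
  define d where "d = (-1) \<cdot>\<^sub>v (L *\<^sub>v \<mu>)"
  have d: "d \<in> carrier_vec r" using L \<mu> by (simp add: d_def)
  define V where "V \<omega> = L *\<^sub>v E \<omega> + d" for \<omega>
  have cov: "L * S * L\<^sup>T = 1\<^sub>m r"
    unfolding S gram_congruence[OF L(1) B(1)] L(2) by simp
  have mean: "L *\<^sub>v \<mu> + d = 0\<^sub>v r" using L \<mu> by (intro eq_vecI) (auto simp: d_def)
  have V: "gaussian_vec M r V (0\<^sub>v r) (1\<^sub>m r)"
    using gaussian_vec_affine_image[OF E L(1) d, of V] unfolding cov mean by (simp add: V_def)
  define R where "R = 1\<^sub>m p - B * L"
  have R: "R \<in> carrier_mat p p" using B L by (simp add: R_def minus_carrier_mat)
  have "R * B = 1\<^sub>m p * B - B * L * B" unfolding R_def using B L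
    by (intro minus_mult_distrib_mat) auto
  also have "B * L * B = B * (L * B)" using B L by (intro assoc_mult_mat) auto
  finally have RB: "R * B = 0\<^sub>m p r" using B L by simp
  have Rcov: "R * S * R\<^sup>T = 0\<^sub>m p p"
    unfolding S gram_congruence[OF R B(1)] RB by simp
  have Rmean: "R *\<^sub>v \<mu> + (-1) \<cdot>\<^sub>v (R *\<^sub>v \<mu>) = 0\<^sub>v p" using R \<mu> by (intro eq_vecI) auto
  have "gaussian_vec M p (\<lambda>\<omega>. R *\<^sub>v E \<omega> + (-1) \<cdot>\<^sub>v (R *\<^sub>v \<mu>)) (0\<^sub>v p) (0\<^sub>m p p)"
    using gaussian_vec_affine_image[OF E R, of "(-1) \<cdot>\<^sub>v (R *\<^sub>v \<mu>)"] R \<mu> unfolding Rcov Rmean by simp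
  then have "AE \<omega> in M. R *\<^sub>v E \<omega> + (-1) \<cdot>\<^sub>v (R *\<^sub>v \<mu>) = 0\<^sub>v p"
    by (rule gaussian_vec_zero_cov_AE)
  then have rep: "AE \<omega> in M. E \<omega> = B *\<^sub>v V \<omega> + \<mu>"
    using AE_space
  proof eventually_elim
    case (elim \<omega>)
    define x where "x = E \<omega>"
    have x: "x \<in> carrier_vec p" using measurable_space[OF EM elim(2)] by (simp add: x_def)
    have Rv: "R *\<^sub>v v = v - B *\<^sub>v (L *\<^sub>v v)" if "v \<in> carrier_vec p" for v
      using that B L unfolding R_def
      by (simp add: minus_mult_distrib_mat_vec[of _ p p] assoc_mult_mat_vec[of B p r L p])
    have c: "B *\<^sub>v (L *\<^sub>v x) \<in> carrier_vec p" "B *\<^sub>v (L *\<^sub>v \<mu>) \<in> carrier_vec p"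
      using B L x \<mu> by auto
    have BV: "B *\<^sub>v V \<omega> = B *\<^sub>v (L *\<^sub>v x) + (-1) \<cdot>\<^sub>v (B *\<^sub>v (L *\<^sub>v \<mu>))"
      unfolding V_def d_def x_def[symmetric] using B L x \<mu>
      by (simp add: mult_add_distrib_mat_vec[of B p r] mult_mat_vec[of B p r])
    have eq: "(x - B *\<^sub>v (L *\<^sub>v x)) + (-1) \<cdot>\<^sub>v (\<mu> - B *\<^sub>v (L *\<^sub>v \<mu>)) = 0\<^sub>v p"
      using elim(1) unfolding x_def[symmetric] Rv[OF x] Rv[OF \<mu>] .
    show ?case unfolding x_def[symmetric] BV
    proof (rule eq_vecI)
      fix i assume "i < dim_vec (B *\<^sub>v (L *\<^sub>v x) + (-1) \<cdot>\<^sub>v (B *\<^sub>v (L *\<^sub>v \<mu>)) + \<mu>)"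
      then have i: "i < p" using \<mu> by simp
      have "x $ i - (B *\<^sub>v (L *\<^sub>v x)) $ i - (\<mu> $ i - (B *\<^sub>v (L *\<^sub>v \<mu>)) $ i) = 0"
        using arg_cong[OF eq, of "\<lambda>v. v $ i"] i x \<mu> c B by (simp del: index_mult_mat_vec)
      then show "x $ i = (B *\<^sub>v (L *\<^sub>v x) + (-1) \<cdot>\<^sub>v (B *\<^sub>v (L *\<^sub>v \<mu>)) + \<mu>) $ i"
        using i x \<mu> c B by (simp del: index_mult_mat_vec)
    qed (use x \<mu> in auto)
  qed
  have "indep_var (vec_borel k) ((\<lambda>v. v) \<circ> Z) (vec_borel r) ((\<lambda>v. L *\<^sub>v v + d) \<circ> E)"
    by (intro indep_var_compose[OF ZE] affine_measurable_vec_borel[OF L(1) d]) simp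
  then have "indep_var (vec_borel k) Z (vec_borel r) V" by (simp add: o_def V_def[abs_def])
  then show thesis using that B V S rep unfolding gaussian_factor_def by blast
qed

section \<open>Absorbing proportional columns\<close>

lemma proportional_sym: "proportional a b \<Longrightarrow> proportional b a"
  unfolding proportional_def
proof (elim exE conjE)
  fix c :: real assume "c \<noteq> 0" "a = c \<cdot>\<^sub>v b"
  then show "\<exists>c. c \<noteq> 0 \<and> b = c \<cdot>\<^sub>v a"
    by (intro exI[of _ "1 / c"]) (auto simp: smult_smult_assoc)
qed

lemma proportional_trans: "proportional a b \<Longrightarrow> proportional b c \<Longrightarrow> proportional a c"
  unfolding proportional_def
proof (elim exE conjE)
  fix x y :: real assume "x \<noteq> 0" "a = x \<cdot>\<^sub>v b" "y \<noteq> 0" "b = y \<cdot>\<^sub>v c"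
  then show "\<exists>x. x \<noteq> 0 \<and> a = x \<cdot>\<^sub>v c"
    by (intro exI[of _ "x * y"]) (auto simp: smult_smult_assoc)
qed

text \<open>The scalar chosen is the only one possible as soon as the columns of \<open>A\<close> are non-zero.\<close>
definition proportionality_coeffs :: "real mat \<Rightarrow> real mat \<Rightarrow> real mat" where
  "proportionality_coeffs A B = mat (dim_col A) (dim_col B)
     (\<lambda>(j,l). if proportional (col B l) (col A j)
              then SOME c. c \<noteq> 0 \<and> col B l = c \<cdot>\<^sub>v col A j else 0)"

lemma proportionality_coeffs_entry:
  assumes "j < dim_col A" "l < dim_col B"
  shows "proportionality_coeffs A B $$ (j,l) \<noteq> 0 \<longleftrightarrow> proportional (col B l) (col A j)"
    and "proportional (col B l) (col A j) \<Longrightarrow> col B l = proportionality_coeffs A B $$ (j,l) \<cdot>\<^sub>v col A j"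
proof -
  have *: "proportionality_coeffs A B $$ (j,l) \<noteq> 0 \<and> col B l = proportionality_coeffs A B $$ (j,l) \<cdot>\<^sub>v col A j"
    if p: "proportional (col B l) (col A j)"
  proof -
    have "\<exists>c. c \<noteq> 0 \<and> col B l = c \<cdot>\<^sub>v col A j" using p by (simp add: proportional_def)
    from someI_ex[OF this] show ?thesis using assms p by (simp add: proportionality_coeffs_def)
  qed
  show "proportionality_coeffs A B $$ (j,l) \<noteq> 0 \<longleftrightarrow> proportional (col B l) (col A j)"
    using * assms by (auto simp: proportionality_coeffs_def)
  show "proportional (col B l) (col A j) \<Longrightarrow> col B l = proportionality_coeffs A B $$ (j,l) \<cdot>\<^sub>v col A j"
    using * by blast
qed

lemma proportionality_coeffs_unique:
  assumes A: "proper_cols A" and j: "j < dim_col A" "j' < dim_col A" and l: "l < dim_col B"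
    and nz: "proportionality_coeffs A B $$ (j,l) \<noteq> 0" "proportionality_coeffs A B $$ (j',l) \<noteq> 0"
  shows "j = j'"
proof (rule ccontr)
  assume "j \<noteq> j'"
  have "proportional (col A j) (col A j')"
    using nz proportionality_coeffs_entry(1)[OF j(1) l] proportionality_coeffs_entry(1)[OF j(2) l]
      proportional_sym proportional_trans by blast
  with A \<open>j \<noteq> j'\<close> j show False by (auto simp: proper_cols_def)
qed

lemma set_free_cols:
  "set (free_cols A B) = {l. l < dim_col B \<and> (\<forall>j<dim_col A. \<not> proportional (col B l) (col A j))}"
  by (auto simp: free_cols_def)

lemma distinct_free_cols: "distinct (free_cols A B)"
  by (simp add: free_cols_def)

text \<open>In matrix form: \<open>A C\<close> agrees with \<open>B\<close> in the columns proportional to a column of \<open>A\<close> and vanishes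
  in all others. At most one \<open>j\<close> contributes to each \<open>l\<close>, since the columns of \<open>A\<close> are pairwise
  non-proportional.\<close>
lemma absorbed_columns:
  assumes A: "A \<in> carrier_mat p k" "proper_cols A" and B: "B \<in> carrier_mat p r" and a: "a < p" and l: "l < r"
  shows "(\<Sum>j<k. A $$ (a,j) * proportionality_coeffs A B $$ (j,l)) =
         (if l \<in> set (free_cols A B) then 0 else B $$ (a,l))"
proof (cases "l \<in> set (free_cols A B)")
  case True
  then have "proportionality_coeffs A B $$ (j,l) = 0" if "j < k" for j
    using proportionality_coeffs_entry(1)[of j A l B] A B l that by (auto simp: set_free_cols)
  then show ?thesis using True by simp
next
  case False
  then obtain j where j: "j < k" "proportional (col B l) (col A j)"
    using A B l by (auto simp: set_free_cols)
  let ?C = "proportionality_coeffs A B"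
  have "?C $$ (j,l) \<noteq> 0" using proportionality_coeffs_entry(1)[of j A l B] A B l j by simp
  then have "?C $$ (i,l) = 0" if "i < k" "i \<noteq> j" for i
    using proportionality_coeffs_unique[OF A(2), of i j l B] that A B l j by auto
  then have "(\<Sum>i<k. A $$ (a,i) * ?C $$ (i,l)) = (\<Sum>i\<in>{j}. A $$ (a,i) * ?C $$ (i,l))"
    using j by (intro sum.mono_neutral_right) auto
  also have "\<dots> = (?C $$ (j,l) \<cdot>\<^sub>v col A j) $ a" using A a j by simp
  also have "?C $$ (j,l) \<cdot>\<^sub>v col A j = col B l"
    using proportionality_coeffs_entry(2)[of j A l B] A B l j by simp
  also have "col B l $ a = B $$ (a,l)" using B a l by simp
  finally show ?thesis using False by simp
qed

lemma full_column_rank_proper_cols: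
  assumes B: "B \<in> carrier_mat p r" and rk: "vec_space.rank p B = r"
  shows "proper_cols B"
proof -
  have inj: "v = 0\<^sub>v r" if "v \<in> carrier_vec r" "B *\<^sub>v v = 0\<^sub>v p" for v
    using full_column_rank_iff_injective[OF B] rk that by blast
  have "col B j \<noteq> 0\<^sub>v p" if "j < r" for j
    using inj[of "unit_vec r j"] mult_mat_unit_vec[OF B that] that by auto
  moreover have "\<not> proportional (col B i) (col B j)" if ij: "i < r" "j < r" "i \<noteq> j" for i j
  proof
    assume "proportional (col B i) (col B j)"
    then obtain c where c: "col B i = c \<cdot>\<^sub>v col B j" by (auto simp: proportional_def)
    let ?v = "unit_vec r i - c \<cdot>\<^sub>v unit_vec r j :: real vec"
    have "B *\<^sub>v ?v = col B i - c \<cdot>\<^sub>v col B j"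
      using B ij by (simp add: mult_minus_distrib_mat_vec[of B p r] mult_mat_vec[of B p r] mult_mat_unit_vec)
    also have "\<dots> = 0\<^sub>v p" unfolding c using B ij by (intro eq_vecI) auto
    finally have "?v = 0\<^sub>v r" by (intro inj) auto
    then have "?v $ i = 0" using ij by simp
    then show False using ij by simp
  qed
  ultimately show ?thesis using B by (auto simp: proper_cols_def)
qed

lemma select_cols_carrier:
  "B \<in> carrier_mat p r \<Longrightarrow> select_cols B J \<in> carrier_mat p (length J)"
  by (auto simp: select_cols_def)

lemma col_select_cols:
  assumes "B \<in> carrier_mat p r" "i < length J" "set J \<subseteq> {..<r}"
  shows "col (select_cols B J) i = col B (J ! i)"
  using assms unfolding select_cols_def by (subst col_mat_of_cols) auto

lemma hcat_carrier:
  "A \<in> carrier_mat p k \<Longrightarrow> B \<in> carrier_mat p q \<Longrightarrow> hcat A B \<in> carrier_mat p (k + q)"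
  by (auto simp: hcat_def)

lemma col_hcat:
  assumes "A \<in> carrier_mat p k" "B \<in> carrier_mat p q" "i < k + q"
  shows "col (hcat A B) i = (if i < k then col A i else col B (i - k))"
  using assms unfolding hcat_def by (subst col_mat_of_cols) (auto simp: nth_append)

lemma sum_lessThan_add_split:
  fixes f :: "nat \<Rightarrow> 'a :: comm_monoid_add"
  shows "(\<Sum>i<k+r. f i) = (\<Sum>i<k. f i) + (\<Sum>l<r. f (k + l))"
  by (induction r) (simp_all add: add.assoc)

lemma hcat_mult_vec_index:
  fixes A :: "real mat"
  assumes A: "A \<in> carrier_mat p k" and B: "B \<in> carrier_mat p q" and y: "y \<in> carrier_vec (k + q)" and a: "a < p"
  shows "(hcat A B *\<^sub>v y) $ a = (\<Sum>i<k. A $$ (a,i) * y $ i) + (\<Sum>l<q. B $$ (a,l) * y $ (k + l))"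
proof -
  note H = hcat_carrier[OF A B]
  have e: "hcat A B $$ (a,i) = (if i < k then A $$ (a,i) else B $$ (a,i-k))" if "i < k + q" for i
    using arg_cong[OF col_hcat[OF A B that], of "\<lambda>v. v $ a"] H A B a that by (auto split: if_splits)
  have "(hcat A B *\<^sub>v y) $ a = (\<Sum>i<k+q. hcat A B $$ (a,i) * y $ i)"
    using H y a by (simp add: scalar_prod_def lessThan_atLeast0)
  then show ?thesis by (simp add: sum_lessThan_add_split e)
qed

lemma proper_cols_hcat_free:
  assumes A: "A \<in> carrier_mat p k" "proper_cols A" and B: "B \<in> carrier_mat p r" "proper_cols B"
  shows "proper_cols (hcat A (select_cols B (free_cols A B)))"
proof -
  define J where "J = free_cols A B"
  have J: "set J \<subseteq> {..<r}" using B by (auto simp: J_def set_free_cols)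
  note B' = select_cols_carrier[OF B(1), of J]
  note H = hcat_carrier[OF A(1) B']
  have Jl: "J ! i < r" "\<And>j. j < k \<Longrightarrow> \<not> proportional (col B (J ! i)) (col A j)" if "i < length J" for i
    using nth_mem[OF that] A B unfolding J_def set_free_cols by auto
  have c: "col (hcat A (select_cols B J)) i = (if i < k then col A i else col B (J ! (i - k)))"
    if "i < k + length J" for i
    using col_hcat[OF A(1) B' that] col_select_cols[OF B(1) _ J, of "i - k"] that by auto
  have nz: "col (hcat A (select_cols B J)) i \<noteq> 0\<^sub>v p" if "i < k + length J" for i
    using A B Jl[of "i - k"] that unfolding c[OF that] by (auto simp: proper_cols_def)
  have np: "\<not> proportional (col (hcat A (select_cols B J)) i) (col (hcat A (select_cols B J)) j)"
    if ij: "i < k + length J" "j < k + length J" "i \<noteq> j" for i j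
  proof -
    consider "i < k" "j < k" | "i < k" "j \<ge> k" | "i \<ge> k" "j < k" | "i \<ge> k" "j \<ge> k" by linarith
    then show ?thesis
    proof cases
      case 4
      then have "J ! (i - k) \<noteq> J ! (j - k)"
        using ij distinct_free_cols[of A B] by (simp add: nth_eq_iff_index_eq J_def)
      then show ?thesis unfolding c[OF ij(1)] c[OF ij(2)] using 4 ij B Jl[of "i - k"] Jl[of "j - k"]
        by (auto simp: proper_cols_def)
    next
      case 2
      then have "j - k < length J" using ij by linarith
      with 2 show ?thesis unfolding c[OF ij(1)] c[OF ij(2)] using Jl(2)[of "j - k" i] proportional_sym by auto
    qed (use A ij Jl[of "i - k"] Jl[of "j - k"] in \<open>auto simp: c proper_cols_def\<close>)
  qed
  from nz np H show ?thesis unfolding proper_cols_def J_def[symmetric] by auto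
qed

lemma select_entries_index:
  "i < length J \<Longrightarrow> select_entries v J $ i = v $ (J ! i)"
  unfolding select_entries_def vec_of_list_index by simp

lemma select_entries_carrier: "select_entries v J \<in> carrier_vec (length J)"
  by (intro carrier_vecI) (simp add: select_entries_def)

text \<open>Selecting entries is multiplication by a matrix with orthonormal rows.\<close>
lemma standard_gaussian_select:
  assumes V: "gaussian_vec M r V (0\<^sub>v r) (1\<^sub>m r)" and J: "distinct J" "set J \<subseteq> {..<r}"
  shows "gaussian_vec M (length J) (\<lambda>\<omega>. select_entries (V \<omega>) J) (0\<^sub>v (length J)) (1\<^sub>m (length J))"
proof -
  define P where "P = mat (length J) r (\<lambda>(i,l). if l = J ! i then 1 else 0 :: real)"
  have P: "P \<in> carrier_mat (length J) r" by (simp add: P_def)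
  have VM: "V \<in> M \<rightarrow>\<^sub>M vec_borel r" using V by (simp add: gaussian_vec_def)
  have Jr: "J ! i < r" if "i < length J" for i using nth_mem[OF that] J by auto
  have sel: "select_entries (V \<omega>) J = P *\<^sub>v V \<omega> + 0\<^sub>v (length J)" if "\<omega> \<in> space M" for \<omega>
  proof -
    have v: "V \<omega> \<in> carrier_vec r" using measurable_space[OF VM that] by simp
    have "(P *\<^sub>v V \<omega>) $ i = V \<omega> $ (J ! i)" if i: "i < length J" for i
    proof -
      have "(P *\<^sub>v V \<omega>) $ i = (\<Sum>l = 0..<r. P $$ (i,l) * V \<omega> $ l)"
        using P v i by (simp add: scalar_prod_def)
      also have "\<dots> = (\<Sum>l = 0..<r. if l = J ! i then V \<omega> $ l else 0)"
        using i by (intro sum.cong) (auto simp: P_def)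
      also have "\<dots> = V \<omega> $ (J ! i)" using Jr[OF i] by simp
      finally show ?thesis .
    qed
    then show ?thesis using P carrier_vecD[OF select_entries_carrier[of "V \<omega>" J]]
      by (intro eq_vecI) (simp_all add: select_entries_index del: index_mult_mat_vec)
  qed
  have cov: "P * 1\<^sub>m r * P\<^sup>T = 1\<^sub>m (length J)"
  proof (rule eq_matI)
    fix a b assume "a < dim_row (1\<^sub>m (length J) :: real mat)" "b < dim_col (1\<^sub>m (length J) :: real mat)"
    then have ab: "a < length J" "b < length J" by auto
    have "(P * 1\<^sub>m r * P\<^sup>T) $$ (a,b) = (\<Sum>l = 0..<r. P $$ (a,l) * P $$ (b,l))"
      using ab P by (simp add: scalar_prod_def)
    also have "\<dots> = (\<Sum>l = 0..<r. (if l = J ! a then (if J ! a = J ! b then 1 else 0) else 0))"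
      using ab by (intro sum.cong) (auto simp: P_def)
    also have "\<dots> = 1\<^sub>m (length J) $$ (a,b)"
      using ab Jr[OF ab(1)] J(1) by (simp add: nth_eq_iff_index_eq)
    finally show "(P * 1\<^sub>m r * P\<^sup>T) $$ (a,b) = 1\<^sub>m (length J) $$ (a,b)" .
  qed (use P in auto)
  have mean: "P *\<^sub>v 0\<^sub>v r + 0\<^sub>v (length J) = 0\<^sub>v (length J)"
    using P by (intro eq_vecI) auto
  have "gaussian_vec M (length J) (\<lambda>\<omega>. select_entries (V \<omega>) J)
      (P *\<^sub>v 0\<^sub>v r + 0\<^sub>v (length J)) (P * 1\<^sub>m r * P\<^sup>T)"
    by (rule gaussian_vec_affine_image[OF V P zero_carrier_vec]) (rule sel)
  then show ?thesis unfolding cov mean .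
qed

lemma sum_nth_distinct:
  assumes "distinct J"
  shows "(\<Sum>i<length J. f (J ! i)) = (\<Sum>l\<in>set J. f l)"
  by (rule sum.reindex_bij_betw[OF bij_betw_nth[OF assms refl refl]])

text \<open>With \<open>C\<close> the matrix of proportionality coefficients, \<open>A Z + B V = A (Z + C V) + B' V'\<close>, where \<open>B'\<close>
  and \<open>V'\<close> keep the columns and entries that \<open>C\<close> does not touch. Each column of \<open>C\<close> has at most
  one non-zero entry. Therefore \<open>W = C V\<close> has the diagonal covariance \<open>C C\<^sup>T\<close>, and the components
  of \<open>Z + W\<close> and \<open>V'\<close> are functions of pairwise disjoint blocks of the scalar variables
  \<open>Z\<^sub>1, \<dots>, Z\<^sub>k, V\<^sub>1, \<dots>, V\<^sub>r\<close>.\<close>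
lemma (in prob_space) absorb_proportional_columns:
  fixes A B :: "real mat" and Z V :: "'a \<Rightarrow> real vec"
  assumes A: "A \<in> carrier_mat p k" "proper_cols A"
    and B: "B \<in> carrier_mat p r"
    and Z: "indep_vars (\<lambda>_. borel) (\<lambda>j \<omega>. Z \<omega> $ j) {..<k}" and ZM: "Z \<in> M \<rightarrow>\<^sub>M vec_borel k"
    and ng: "\<forall>j<k. \<not> gaussian_rv M (\<lambda>\<omega>. Z \<omega> $ j)"
    and V: "gaussian_vec M r V (0\<^sub>v r) (1\<^sub>m r)"
    and ZV: "indep_var (vec_borel k) Z (vec_borel r) V"
  defines "J \<equiv> free_cols A B"
  defines "V' \<equiv> \<lambda>\<omega>. select_entries (V \<omega>) J"
  shows "\<exists>\<Gamma> W. \<Gamma> \<in> carrier_mat k k \<and> diagonal_mat \<Gamma> \<and> gaussian_vec M k W (0\<^sub>v k) \<Gamma> \<and>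
    indep_vars (\<lambda>i. vec_borel ([k, k, length J] ! i)) (\<lambda>i. [Z, W, V'] ! i) {..<3} \<and>
    (\<forall>\<omega>\<in>space M. hcat A (select_cols B J) *\<^sub>v ((Z \<omega> + W \<omega>) @\<^sub>v V' \<omega>) = A *\<^sub>v Z \<omega> + B *\<^sub>v V \<omega>) \<and>
    (\<forall>j<k. \<not> gaussian_rv M (\<lambda>\<omega>. (Z \<omega> + W \<omega>) $ j)) \<and>
    indep_vars (\<lambda>_. borel) (\<lambda>i \<omega>. ((Z \<omega> + W \<omega>) @\<^sub>v V' \<omega>) $ i) {..<k + length J} \<and>
    (\<forall>i<k + length J. nonconstant_rv M (\<lambda>\<omega>. ((Z \<omega> + W \<omega>) @\<^sub>v V' \<omega>) $ i))"
proof -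
  let ?r' = "length J"
  define C where "C = proportionality_coeffs A B"
  have C: "C \<in> carrier_mat k r" using A B by (simp add: C_def proportionality_coeffs_def)
  have J: "distinct J" "set J \<subseteq> {..<r}" using B by (auto simp: J_def distinct_free_cols set_free_cols)
  have Jr: "J ! i < r" if "i < ?r'" for i using nth_mem[OF that] J by auto
  have CJ: "C $$ (j,l) = 0" if "j < k" "l \<in> set J" for j l
  proof -
    have "l < dim_col B" "\<not> proportional (col B l) (col A j)"
      using that A(1) by (auto simp: J_def set_free_cols)
    then show ?thesis using proportionality_coeffs_entry(1)[of j A l B] that(1) A(1) by (simp add: C_def)
  qed
  have C_unique: "j = j'" if "j < k" "j' < k" "l < r" "C $$ (j,l) \<noteq> 0" "C $$ (j',l) \<noteq> 0" for j j' l
    using proportionality_coeffs_unique[OF A(2), of j j' l B] that A(1) B by (simp add: C_def)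
  have VM: "V \<in> M \<rightarrow>\<^sub>M vec_borel r" using V by (simp add: gaussian_vec_def)
  have Zc: "Z \<omega> \<in> carrier_vec k" and Vc: "V \<omega> \<in> carrier_vec r" if "\<omega> \<in> space M" for \<omega>
    using measurable_space[OF ZM that] measurable_space[OF VM that] by auto
  define W where "W \<omega> = C *\<^sub>v V \<omega>" for \<omega>
  have Wc: "W \<omega> \<in> carrier_vec k" for \<omega> using C by (intro carrier_vecI) (simp add: W_def)
  have Wi: "W \<omega> $ j = (\<Sum>l<r. C $$ (j,l) * V \<omega> $ l)" if "\<omega> \<in> space M" "j < k" for \<omega> j
    using Vc[OF that(1)] C that(2) by (simp add: W_def scalar_prod_def lessThan_atLeast0)
  have V'c: "V' \<omega> \<in> carrier_vec ?r'" and V'i: "i < ?r' \<Longrightarrow> V' \<omega> $ i = V \<omega> $ (J ! i)" for \<omega> i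
    by (simp_all add: V'_def select_entries_carrier select_entries_index)
  define \<Gamma> where "\<Gamma> = C * 1\<^sub>m r * C\<^sup>T"
  have \<Gamma>: "\<Gamma> \<in> carrier_mat k k" using C by (simp add: \<Gamma>_def)
  have "\<Gamma> $$ (i,j) = 0" if ij: "i < k" "j < k" "i \<noteq> j" for i j
  proof -
    have "\<Gamma> $$ (i,j) = (\<Sum>l = 0..<r. C $$ (i,l) * C $$ (j,l))"
      using ij C by (simp add: \<Gamma>_def scalar_prod_def)
    also have "\<dots> = 0" using C_unique[of i j] ij by (intro sum.neutral) force
    finally show ?thesis .
  qed
  then have diag: "diagonal_mat \<Gamma>" using \<Gamma> by (auto simp: diagonal_mat_def)
  have W: "gaussian_vec M k W (0\<^sub>v k) \<Gamma>"
  proof -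
    have "C *\<^sub>v 0\<^sub>v r + 0\<^sub>v k = 0\<^sub>v k" using C by (intro eq_vecI) auto
    then show ?thesis
      using gaussian_vec_affine_image[OF V C, of "0\<^sub>v k" W] Wc by (simp add: W_def \<Gamma>_def)
  qed
  \<comment> \<open>The scalar variables as one family: \<open>Z\<close> at the indices below \<open>k\<close>, then \<open>V\<close>.\<close>
  define U where "U i \<omega> = (if i < k then Z \<omega> $ i else V \<omega> $ (i - k))" for i \<omega>
  have U: "indep_vars (\<lambda>_. borel) U {..<k+r}"
    using indep_components_joint[OF Z standard_gaussian_components_indep[OF V] ZV]
    by (simp add: U_def[abs_def])
  have Uk: "U (k + l) \<omega> = V \<omega> $ l" for l \<omega> by (simp add: U_def)
  have blocks: "indep_vars (\<lambda>i. vec_borel ([k, k, ?r'] ! i)) (\<lambda>i. [Z, W, V'] ! i) {..<3}"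
  proof (rule indep_vars_functions_of_blocks[OF U])
    define K where "K j = [{..<k}, (+) k ` ({..<r} - set J), (+) k ` set J] ! j" for j :: nat
    define f where "f j = [\<lambda>g. vec k g, \<lambda>g. vec k (\<lambda>i. \<Sum>l\<in>{..<r} - set J. C $$ (i,l) * g (k + l)),
        \<lambda>g. vec ?r' (\<lambda>i. g (k + J ! i))] ! j" for j :: nat
    have three: "j = 0 \<or> j = 1 \<or> j = 2" if "j \<in> {..<3}" for j :: nat using that by auto
    show "K j \<subseteq> {..<k+r}" if "j \<in> {..<3}" for j
      using three[OF that] subsetD[OF J(2)] by (auto simp: K_def)
    show "disjoint_family_on K {..<3}"
      unfolding disjoint_family_on_def
    proof (intro ballI impI)
      fix i j :: nat assume "i \<in> {..<3}" "j \<in> {..<3}" "i \<noteq> j"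
      then consider "i = 0" "j = 1" | "i = 0" "j = 2" | "i = 1" "j = 0" | "i = 1" "j = 2" | "i = 2" "j = 0" | "i = 2" "j = 1"
        using three[of i] three[of j] by blast
      then show "K i \<inter> K j = {}" by cases (auto simp: K_def)
    qed
    show "f j \<in> PiM (K j) (\<lambda>_. borel) \<rightarrow>\<^sub>M vec_borel ([k, k, ?r'] ! j)" if "j \<in> {..<3}" for j
      using three[OF that] J Jr unfolding measurable_vec_borel_iff
      by (auto simp: K_def f_def intro!: borel_measurable_sum borel_measurable_times measurable_component_singleton)
    fix j \<omega> assume j: "j \<in> {..<3::nat}" and \<omega>: "\<omega> \<in> space M"
    have "W \<omega> $ i = (\<Sum>l\<in>{..<r} - set J. C $$ (i,l) * V \<omega> $ l)" if "i < k" for i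
      unfolding Wi[OF \<omega> that] using CJ[OF that] by (intro sum.mono_neutral_right) auto
    then show "([Z, W, V'] ! j) \<omega> = f j (restrict (\<lambda>i. U i \<omega>) (K j))"
      using three[OF j] Zc[OF \<omega>] Wc[of \<omega>] V'c[of \<omega>]
      by (auto simp: K_def f_def U_def V'i intro!: eq_vecI sum.cong)
  qed
  have comp: "((Z \<omega> + W \<omega>) @\<^sub>v V' \<omega>) $ i = (if i < k then Z \<omega> $ i + W \<omega> $ i else V \<omega> $ (J ! (i - k)))"
    if "i < k + ?r'" for i \<omega>
    using that carrier_vecD[OF Wc[of \<omega>]] carrier_vecD[OF V'c[of \<omega>]] V'i[of "i - k" \<omega>] by auto
  have Yindep: "indep_vars (\<lambda>_. borel) (\<lambda>i \<omega>. ((Z \<omega> + W \<omega>) @\<^sub>v V' \<omega>) $ i) {..<k + ?r'}"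
  proof (rule indep_vars_functions_of_blocks[OF U])
    define D where "D i = {l. l < r \<and> C $$ (i,l) \<noteq> 0}" for i
    define K where "K i = (if i < k then insert i ((+) k ` D i) else {k + J ! (i - k)})" for i
    define f where "f i g = (if i < k then g i + (\<Sum>l\<in>D i. C $$ (i,l) * g (k + l)) else g (k + J ! (i - k)))"
      for i and g :: "nat \<Rightarrow> real"
    show "K i \<subseteq> {..<k+r}" if "i \<in> {..<k + ?r'}" for i
      using that Jr[of "i - k"] by (auto simp: K_def D_def)
    show "disjoint_family_on K {..<k + ?r'}"
      unfolding disjoint_family_on_def
    proof (intro ballI impI)
      fix i j assume ij: "i \<in> {..<k + ?r'}" "j \<in> {..<k + ?r'}" "i \<noteq> j"
      have DJ: "l \<notin> D a" if "l \<in> set J" "a < k" for a l using CJ that by (auto simp: D_def)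
      have DD: "D i \<inter> D j = {}" if "i < k" "j < k"
        using C_unique[of i j] that ij(3) by (auto simp: D_def)
      consider "i < k" "j < k" | "i < k" "j \<ge> k" | "i \<ge> k" "j < k" | "i \<ge> k" "j \<ge> k" by linarith
      then show "K i \<inter> K j = {}"
      proof cases
        case 1 then show ?thesis using DD ij(3) by (auto simp: K_def)
      next
        case 2
        then have "j - k < ?r'" using ij by auto
        with 2 show ?thesis using ij DJ[OF nth_mem, of "j - k" i] by (auto simp: K_def)
      next
        case 3
        then have "i - k < ?r'" using ij by auto
        with 3 show ?thesis using ij DJ[OF nth_mem, of "i - k" j] by (auto simp: K_def)
      next
        case 4 then show ?thesis using ij J(1) by (auto simp: K_def nth_eq_iff_index_eq)
      qed
    qed
    show "f i \<in> PiM (K i) (\<lambda>_. borel) \<rightarrow>\<^sub>M borel" if "i \<in> {..<k + ?r'}" for i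
      unfolding f_def[abs_def]
      by (cases "i < k")
         (auto simp: K_def intro!: borel_measurable_add borel_measurable_sum borel_measurable_times
            measurable_component_singleton)
    fix i \<omega> assume i: "i \<in> {..<k + ?r'}" and \<omega>: "\<omega> \<in> space M"
    have "W \<omega> $ i = (\<Sum>l\<in>D i. C $$ (i,l) * V \<omega> $ l)" if "i < k"
      unfolding Wi[OF \<omega> that] by (intro sum.mono_neutral_right) (auto simp: D_def)
    then show "((Z \<omega> + W \<omega>) @\<^sub>v V' \<omega>) $ i = f i (restrict (\<lambda>i. U i \<omega>) (K i))"
      using i by (subst comp) (auto simp: f_def K_def U_def intro!: sum.cong)
  qed
  have rep: "hcat A (select_cols B J) *\<^sub>v ((Z \<omega> + W \<omega>) @\<^sub>v V' \<omega>) = A *\<^sub>v Z \<omega> + B *\<^sub>v V \<omega>"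
    if \<omega>: "\<omega> \<in> space M" for \<omega>
  proof (rule eq_vecI)
    note B' = select_cols_carrier[OF B, of J]
    fix a assume "a < dim_vec (A *\<^sub>v Z \<omega> + B *\<^sub>v V \<omega>)"
    then have a: "a < p" using B by simp
    have y: "(Z \<omega> + W \<omega>) @\<^sub>v V' \<omega> \<in> carrier_vec (k + ?r')"
      using Zc[OF \<omega>] Wc V'c by (intro append_carrier_vec) auto
    have sel: "select_cols B J $$ (a,l) = B $$ (a, J ! l)" if "l < ?r'" for l
      using arg_cong[OF col_select_cols[OF B that J(2)], of "\<lambda>v. v $ a"] a B B' that Jr[OF that] by auto
    have "(\<Sum>i<k. A $$ (a,i) * W \<omega> $ i) = (\<Sum>i<k. \<Sum>l<r. A $$ (a,i) * C $$ (i,l) * V \<omega> $ l)"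
      by (intro sum.cong refl) (simp add: Wi[OF \<omega>] sum_distrib_left mult.assoc)
    also have "\<dots> = (\<Sum>l<r. (\<Sum>i<k. A $$ (a,i) * C $$ (i,l)) * V \<omega> $ l)"
      by (subst sum.swap) (simp add: sum_distrib_right)
    also have "\<dots> = (\<Sum>l<r. (if l \<in> set J then 0 else B $$ (a,l)) * V \<omega> $ l)"
      using absorbed_columns[OF A B a] by (simp add: C_def J_def)
    finally have AW: "(\<Sum>i<k. A $$ (a,i) * W \<omega> $ i) = \<dots>" .
    have "(\<Sum>l<?r'. B $$ (a, J ! l) * V \<omega> $ (J ! l)) = (\<Sum>l\<in>set J. B $$ (a,l) * V \<omega> $ l)"
      by (rule sum_nth_distinct[OF J(1)])
    also have "\<dots> = (\<Sum>l<r. (if l \<in> set J then B $$ (a,l) else 0) * V \<omega> $ l)"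
      using J(2) by (intro sum.mono_neutral_cong_left) auto
    finally have BV: "(\<Sum>l<?r'. B $$ (a, J ! l) * V \<omega> $ (J ! l)) = \<dots>" .
    have "(hcat A (select_cols B J) *\<^sub>v ((Z \<omega> + W \<omega>) @\<^sub>v V' \<omega>)) $ a =
        (\<Sum>i<k. A $$ (a,i) * (Z \<omega> $ i + W \<omega> $ i)) + (\<Sum>l<?r'. B $$ (a, J ! l) * V \<omega> $ (J ! l))"
      unfolding hcat_mult_vec_index[OF A(1) B' y a] by (simp add: comp sel)
    also have "\<dots> = (\<Sum>i<k. A $$ (a,i) * Z \<omega> $ i) +
        ((\<Sum>i<k. A $$ (a,i) * W \<omega> $ i) + (\<Sum>l<?r'. B $$ (a, J ! l) * V \<omega> $ (J ! l)))"
      by (simp add: distrib_left sum.distrib)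
    also have "(\<Sum>i<k. A $$ (a,i) * W \<omega> $ i) + (\<Sum>l<?r'. B $$ (a, J ! l) * V \<omega> $ (J ! l)) =
        (\<Sum>l<r. B $$ (a,l) * V \<omega> $ l)"
      unfolding AW BV sum.distrib[symmetric] by (intro sum.cong) auto
    also have "(\<Sum>i<k. A $$ (a,i) * Z \<omega> $ i) + \<dots> = (A *\<^sub>v Z \<omega> + B *\<^sub>v V \<omega>) $ a"
      using A(1) B a Zc[OF \<omega>] Vc[OF \<omega>] by (simp add: scalar_prod_def lessThan_atLeast0)
    finally show "(hcat A (select_cols B J) *\<^sub>v ((Z \<omega> + W \<omega>) @\<^sub>v V' \<omega>)) $ a = (A *\<^sub>v Z \<omega> + B *\<^sub>v V \<omega>) $ a" .
  qed (use hcat_carrier[OF A(1) select_cols_carrier[OF B]] B in auto)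
  have ngY: "\<not> gaussian_rv M (\<lambda>\<omega>. (Z \<omega> + W \<omega>) $ j)" if j: "j < k" for j
  proof
    assume "gaussian_rv M (\<lambda>\<omega>. (Z \<omega> + W \<omega>) $ j)"
    then have sum: "gaussian_rv M (\<lambda>\<omega>. Z \<omega> $ j + W \<omega> $ j)"
      using carrier_vecD[OF Wc] j by simp
    have "(\<lambda>v. (C *\<^sub>v v + 0\<^sub>v k) $ j) \<in> borel_measurable (vec_borel r)"
      using measurable_compose[OF affine_measurable_vec_borel[OF C, of "0\<^sub>v k"] vec_borel_component_measurable[OF j]]
      by simp
    then have "indep_var borel ((\<lambda>v. v $ j) \<circ> Z) borel ((\<lambda>v. (C *\<^sub>v v + 0\<^sub>v k) $ j) \<circ> V)"
      using j by (intro indep_var_compose[OF ZV]) auto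
    then have ind: "indep_var borel (\<lambda>\<omega>. Z \<omega> $ j) borel (\<lambda>\<omega>. W \<omega> $ j)"
      using Wc j by (simp add: o_def W_def)
    have "char (distr M borel (\<lambda>\<omega>. W \<omega> $ j)) s = exp (- complex_of_real (\<Gamma> $$ (j,j) * s\<^sup>2) / 2)" for s
      using gaussian_vec_component_char(1)[OF W j, of s] j by simp
    from gaussian_rv_summand[OF ind this sum] ng j show False by blast
  qed
  have nc: "nonconstant_rv M (\<lambda>\<omega>. ((Z \<omega> + W \<omega>) @\<^sub>v V' \<omega>) $ i)" if i: "i < k + ?r'" for i
  proof (cases "i < k")
    case True
    have "(\<lambda>\<omega>. ((Z \<omega> + W \<omega>) @\<^sub>v V' \<omega>) $ i) \<in> borel_measurable M"
      using Yindep i by (auto simp: indep_vars_def)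
    moreover have "(\<lambda>\<omega>. ((Z \<omega> + W \<omega>) @\<^sub>v V' \<omega>) $ i) = (\<lambda>\<omega>. (Z \<omega> + W \<omega>) $ i)"
      using carrier_vecD[OF Wc] True by (intro ext) simp
    ultimately show ?thesis using non_gaussian_nonconstant ngY[OF True] by simp
  next
    case False
    then have l: "J ! (i - k) < r" using i Jr by simp
    have "(\<lambda>\<omega>. ((Z \<omega> + W \<omega>) @\<^sub>v V' \<omega>) $ i) = (\<lambda>\<omega>. V \<omega> $ (J ! (i - k)))"
      using comp[OF i] False by simp
    moreover have "nonconstant_rv M (\<lambda>\<omega>. V \<omega> $ (J ! (i - k)))"
      using gaussian_vec_component_char(1)[OF V l] l by (intro standard_normal_nonconstant) simp
    ultimately show ?thesis by simp
  qed
  show ?thesis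
    by (intro exI[of _ \<Gamma>] exI[of _ W] conjI ballI allI impI \<Gamma> diag W blocks rep ngY Yindep nc; assumption)
qed

section \<open>The two representations\<close>

theorem lemma5p2:
  fixes M :: "'a measure" and p k r :: nat
    and X Z E :: "'a \<Rightarrow> real vec"
    and A \<Sigma> :: "real mat" and \<mu> :: "real vec"
  assumes "prob_space M"
    and "X \<in> M \<rightarrow>\<^sub>M vec_borel p"
    and "A \<in> carrier_mat p k"
    and "proper_cols A"
    and "Z \<in> M \<rightarrow>\<^sub>M vec_borel k"
    and "prob_space.indep_vars M (\<lambda>_. borel) (\<lambda>j \<omega>. Z \<omega> $ j) {..<k}"
    and "\<forall>j<k. nonconstant_rv M (\<lambda>\<omega>. Z \<omega> $ j)"
    and "\<forall>j<k. \<not> gaussian_rv M (\<lambda>\<omega>. Z \<omega> $ j)"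
    and "gaussian_vec M p E \<mu> \<Sigma>"
    and "vec_space.rank p \<Sigma> = r"
    and "prob_space.indep_var M (vec_borel k) Z (vec_borel p) E"
    and "AE \<omega> in M. X \<omega> = A *\<^sub>v Z \<omega> + E \<omega>"
  shows
    "(\<exists>B V. gaussian_factor M p k r Z E \<mu> \<Sigma> B V
        \<and> (AE \<omega> in M. X \<omega> = A *\<^sub>v Z \<omega> + B *\<^sub>v V \<omega> + \<mu>)
        \<and> (r = 0 \<longrightarrow> B = 0\<^sub>m p 0 \<and> (\<forall>\<omega>\<in>space M. V \<omega> = 0\<^sub>v 0) \<and> (AE \<omega> in M. E \<omega> = \<mu>)))
     \<and> (r \<ge> 2 \<longrightarrow>
         (\<exists>B V. gaussian_factor M p k r Z E \<mu> \<Sigma> B V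
            \<and> (AE \<omega> in M. X \<omega> = A *\<^sub>v Z \<omega> + B *\<^sub>v V \<omega> + \<mu>)
            \<and> (\<forall>l<r. \<forall>j<k. \<not> proportional (col B l) (col A j))))
     \<and> (\<forall>B V. gaussian_factor M p k r Z E \<mu> \<Sigma> B V \<longrightarrow>
         (let J = free_cols A B;
              r' = length J;
              B' = select_cols B J;
              V' = (\<lambda>\<omega>. select_entries (V \<omega>) J)
          in r' \<le> r
           \<and> gaussian_vec M r' V' (0\<^sub>v r') (1\<^sub>m r')
           \<and> (\<exists>\<Gamma> W. \<Gamma> \<in> carrier_mat k k \<and> diagonal_mat \<Gamma>
                \<and> gaussian_vec M k W (0\<^sub>v k) \<Gamma>
                \<and> prob_space.indep_vars M
                     (\<lambda>i. vec_borel ([k, k, r'] ! i)) (\<lambda>i. [Z, W, V'] ! i) {..<3}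
                \<and> (let Z' = (\<lambda>\<omega>. Z \<omega> + W \<omega>); Y = (\<lambda>\<omega>. Z' \<omega> @\<^sub>v V' \<omega>)
                   in (AE \<omega> in M. X \<omega> = hcat A B' *\<^sub>v Y \<omega> + \<mu>)
                    \<and> (\<forall>j<k. \<not> gaussian_rv M (\<lambda>\<omega>. Z' \<omega> $ j))
                    \<and> prob_space.indep_vars M (\<lambda>_. borel) (\<lambda>i \<omega>. Y \<omega> $ i) {..<k + r'}
                    \<and> (\<forall>i<k + r'. nonconstant_rv M (\<lambda>\<omega>. Y \<omega> $ i))
                    \<and> proper_cols (hcat A B')))))"
proof -
  interpret prob_space M by (rule assms(1))
  note A = assms(3,4)
  note E = assms(9)
  have S: "psd_mat p \<Sigma>" and EM: "E \<in> M \<rightarrow>\<^sub>M vec_borel p" and \<mu>: "\<mu> \<in> carrier_vec p"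
    using E by (auto simp: gaussian_vec_def)
  obtain B where B: "B \<in> carrier_mat p r" "\<Sigma> = B * B\<^sup>T" "vec_space.rank p B = r"
    using psd_factor[OF S] assms(10) by metis
  \<comment> \<open>The representation of \<open>X\<close> holds for every factor, so it is shared by all three parts.\<close>
  have repX: "AE \<omega> in M. X \<omega> = A *\<^sub>v Z \<omega> + B *\<^sub>v V \<omega> + \<mu>"
    if g: "gaussian_factor M p k r Z E \<mu> \<Sigma> B V" for B V
  proof -
    have EV: "AE \<omega> in M. E \<omega> = B *\<^sub>v V \<omega> + \<mu>" and BC: "B \<in> carrier_mat p r" and VM: "V \<in> M \<rightarrow>\<^sub>M vec_borel r"
      using g by (auto simp: gaussian_factor_def gaussian_vec_def)
    show ?thesis using assms(12) EV AE_space
    proof eventually_elim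
      case (elim \<omega>)
      have "Z \<omega> \<in> carrier_vec k" "V \<omega> \<in> carrier_vec r"
        using measurable_space[OF assms(5) elim(3)] measurable_space[OF VM elim(3)] by auto
      then show ?case using elim A BC \<mu> by (simp add: assoc_add_vec[of _ p])
    qed
  qed
  have part1: "\<exists>B V. gaussian_factor M p k r Z E \<mu> \<Sigma> B V
        \<and> (AE \<omega> in M. X \<omega> = A *\<^sub>v Z \<omega> + B *\<^sub>v V \<omega> + \<mu>)
        \<and> (r = 0 \<longrightarrow> B = 0\<^sub>m p 0 \<and> (\<forall>\<omega>\<in>space M. V \<omega> = 0\<^sub>v 0) \<and> (AE \<omega> in M. E \<omega> = \<mu>))"
  proof -
    obtain V where V: "gaussian_factor M p k r Z E \<mu> \<Sigma> B V"
      using gaussian_factor_of_factorisation[OF E assms(11) B(1,3,2)] by blast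
    have VM: "V \<in> M \<rightarrow>\<^sub>M vec_borel r" and EV: "AE \<omega> in M. E \<omega> = B *\<^sub>v V \<omega> + \<mu>"
      using V by (auto simp: gaussian_factor_def gaussian_vec_def)
    have V0: "V \<omega> = 0\<^sub>v 0" if "r = 0" "\<omega> \<in> space M" for \<omega>
      using measurable_space[OF VM that(2)] that(1) by (intro eq_vecI) auto
    have B0: "B = 0\<^sub>m p 0" if "r = 0" using B(1) that by (intro eq_matI) auto
    have "AE \<omega> in M. E \<omega> = \<mu>" if r: "r = 0"
      using EV AE_space
    proof eventually_elim
      case (elim \<omega>)
      have "B *\<^sub>v V \<omega> = 0\<^sub>v p" unfolding V0[OF r elim(2)] B0[OF r] by (intro eq_vecI) auto
      then show ?case using elim \<mu> by simp
    qed
    then show ?thesis using V repX[OF V] V0 B0 by blast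
  qed
  have part2: "\<exists>B V. gaussian_factor M p k r Z E \<mu> \<Sigma> B V
        \<and> (AE \<omega> in M. X \<omega> = A *\<^sub>v Z \<omega> + B *\<^sub>v V \<omega> + \<mu>)
        \<and> (\<forall>l<r. \<forall>j<k. \<not> proportional (col B l) (col A j))" if r: "r \<ge> 2"
  proof -
    obtain B' where B': "B' \<in> carrier_mat p r" "vec_space.rank p B' = r" "B' * B'\<^sup>T = B * B\<^sup>T"
      "\<And>l j. l < r \<Longrightarrow> j < k \<Longrightarrow> \<not> proportional (col B' l) (col A j)"
      using rotate_factor_off_columns[OF B(1,3) A(1) r] by blast
    obtain V where V: "gaussian_factor M p k r Z E \<mu> \<Sigma> B' V"
      using gaussian_factor_of_factorisation[OF E assms(11) B'(1,2)] B'(3) B(2) by metis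
    then show ?thesis using repX[OF V] B'(4) by blast
  qed
  show ?thesis
  proof (intro conjI impI allI part1 part2)
    fix B V assume g: "gaussian_factor M p k r Z E \<mu> \<Sigma> B V"
    then have B: "B \<in> carrier_mat p r" "vec_space.rank p B = r"
      and V: "gaussian_vec M r V (0\<^sub>v r) (1\<^sub>m r)" and ZV: "indep_var (vec_borel k) Z (vec_borel r) V"
      by (auto simp: gaussian_factor_def)
    define J where "J = free_cols A B"
    define V' where "V' \<omega> = select_entries (V \<omega>) J" for \<omega>
    have J: "distinct J" "set J \<subseteq> {..<r}" using B by (auto simp: J_def distinct_free_cols set_free_cols)
    have len: "length J \<le> r"
      using card_mono[OF _ J(2)] distinct_card[OF J(1)] by simp
    have V': "gaussian_vec M (length J) V' (0\<^sub>v (length J)) (1\<^sub>m (length J))"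
      unfolding V'_def[abs_def] by (rule standard_gaussian_select[OF V J])
    obtain \<Gamma> W where GW: "\<Gamma> \<in> carrier_mat k k" "diagonal_mat \<Gamma>" "gaussian_vec M k W (0\<^sub>v k) \<Gamma>"
      "indep_vars (\<lambda>i. vec_borel ([k, k, length J] ! i)) (\<lambda>i. [Z, W, V'] ! i) {..<3}"
      "\<forall>\<omega>\<in>space M. hcat A (select_cols B J) *\<^sub>v ((Z \<omega> + W \<omega>) @\<^sub>v V' \<omega>) = A *\<^sub>v Z \<omega> + B *\<^sub>v V \<omega>"
      "\<forall>j<k. \<not> gaussian_rv M (\<lambda>\<omega>. (Z \<omega> + W \<omega>) $ j)"
      "indep_vars (\<lambda>_. borel) (\<lambda>i \<omega>. ((Z \<omega> + W \<omega>) @\<^sub>v V' \<omega>) $ i) {..<k + length J}"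
      "\<forall>i<k + length J. nonconstant_rv M (\<lambda>\<omega>. ((Z \<omega> + W \<omega>) @\<^sub>v V' \<omega>) $ i)"
      using absorb_proportional_columns[OF A B(1) assms(6,5,8) V ZV]
      unfolding J_def[symmetric] V'_def[symmetric] by (elim exE conjE) (rule that)
    have X': "AE \<omega> in M. X \<omega> = hcat A (select_cols B J) *\<^sub>v ((Z \<omega> + W \<omega>) @\<^sub>v V' \<omega>) + \<mu>"
      using repX[OF g] AE_space by eventually_elim (simp add: GW(5))
    have distinct_dirs: "proper_cols (hcat A (select_cols B J))"
      unfolding J_def by (rule proper_cols_hcat_free[OF A B(1) full_column_rank_proper_cols[OF B]])
    show "let J = free_cols A B;
              r' = length J;
              B' = select_cols B J;
              V' = (\<lambda>\<omega>. select_entries (V \<omega>) J)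
          in r' \<le> r
           \<and> gaussian_vec M r' V' (0\<^sub>v r') (1\<^sub>m r')
           \<and> (\<exists>\<Gamma> W. \<Gamma> \<in> carrier_mat k k \<and> diagonal_mat \<Gamma>
                \<and> gaussian_vec M k W (0\<^sub>v k) \<Gamma>
                \<and> prob_space.indep_vars M
                     (\<lambda>i. vec_borel ([k, k, r'] ! i)) (\<lambda>i. [Z, W, V'] ! i) {..<3}
                \<and> (let Z' = (\<lambda>\<omega>. Z \<omega> + W \<omega>); Y = (\<lambda>\<omega>. Z' \<omega> @\<^sub>v V' \<omega>)
                   in (AE \<omega> in M. X \<omega> = hcat A B' *\<^sub>v Y \<omega> + \<mu>)
                    \<and> (\<forall>j<k. \<not> gaussian_rv M (\<lambda>\<omega>. Z' \<omega> $ j))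
                    \<and> prob_space.indep_vars M (\<lambda>_. borel) (\<lambda>i \<omega>. Y \<omega> $ i) {..<k + r'}
                    \<and> (\<forall>i<k + r'. nonconstant_rv M (\<lambda>\<omega>. Y \<omega> $ i))
                    \<and> proper_cols (hcat A B')))"
      unfolding Let_def J_def[symmetric] V'_def[symmetric]
      by (intro conjI exI[of _ \<Gamma>] exI[of _ W] len V' GW(1-4) X' GW(6-8) distinct_dirs)
  qed
qed

end
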